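(* Fix $k\in\mathbb N$ and let $p_{\mathbb P_k}(n)$ be the number of partitions of $n$ with all parts in $\mathbb P_k=\{p^k: p\text{ prime}\}$. Let $\Psi(z)=\prod_{p\text{ prime}}(1-z^{p^k})^{-1}=\sum_{n\ge0}p_{\mathbb P_k}(n)z^n$ and $\Phi(z)=\sum_{j=1}^\infty\sum_{p\text{ prime}}\frac1j z^{jp^k}$ (so $\Psi=\exp\Phi$) for $|z|<1$. Let $\rho=\rho(n)\in(0,1)$ be defined by $n=\rho\Phi'(\rho)$ and let $\Phi_{(2)}(\rho)=\left(\rho\frac{d}{d\rho}\right)^2\Phi(\rho)$. Then $$p_{\mathbb P_k}(n)=\frac{\rho^{-n}\Psi(\rho)}{\sqrt{2\pi\Phi_{(2)}(\rho)}}\left(1+O\left(n^{-\frac1{2k+3}}\right)\right).$$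
   Context: The map $\rho\mapsto\rho\Phi'(\rho)$ is continuous and strictly increasing on $(0,1)$ tending to $\infty$ as $\rho\to1^-$, so $\rho(n)$ is well defined for large $n$. Implicit constants may depend on $k$. *)

theory Defs
  imports "HOL-Analysis.Analysis" "HOL-Library.Multiset" "HOL-Library.Landau_Symbols"
    "HOL-Computational_Algebra.Primes"
begin

definition partPk :: "nat \<Rightarrow> nat \<Rightarrow> nat" where
  "partPk k n = card {M :: nat multiset.
      (\<forall>x \<in># M. \<exists>p. prime p \<and> x = p ^ k) \<and> sum_mset M = n}"

definition Phi :: "nat \<Rightarrow> real \<Rightarrow> real" where
  "Phi k z = (\<Sum>p. if prime p then (\<Sum>j. z ^ (Suc j * p ^ k) / real (Suc j)) else 0)"

definition Psi :: "nat \<Rightarrow> real \<Rightarrow> real" where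
  "Psi k z = (\<Prod>p. if prime p then 1 / (1 - z ^ (p ^ k)) else 1)"

definition rho :: "nat \<Rightarrow> nat \<Rightarrow> real" where
  "rho k n = (THE r. 0 < r \<and> r < 1 \<and> r * deriv (Phi k) r = real n)"

definition Phi2 :: "nat \<Rightarrow> real \<Rightarrow> real" where
  "Phi2 k r = r * deriv (\<lambda>s. s * deriv (Phi k) s) r"

definition main_term :: "nat \<Rightarrow> nat \<Rightarrow> real" where
  "main_term k n = (let r = rho k n in
     r powr (- real n) * Psi k r / sqrt (2 * pi * Phi2 k r))"

end

theory Submission
  imports Defs "HOL-Probability.Characteristic_Functions"
begin

text \<open>
  Write \<open>\<rho> = exp (- t)\<close> with \<open>t = y\<^sup>-\<^sup>k\<close>. Then \<open>p(n) \<rho>\<^sup>n / \<Psi>(\<rho>)\<close> is the probability that the sum over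
  all primes \<open>p\<close> of \<open>p\<^sup>k\<close> times independent geometric random variables with parameter \<open>\<rho> ^ p\<^sup>k\<close> takes
  the value \<open>n\<close>. By the choice of \<open>\<rho>\<close> its mean is \<open>n\<close>, and its variance is \<open>\<Phi>\<^sub>(\<^sub>2\<^sub>)(\<rho>)\<close>; the claim
  is a local limit theorem, proved by Fourier inversion.

  For \<open>\<bar>\<theta>\<bar>\<close> up to about \<open>y powr (- k - 1/3)\<close> the characteristic function is Gaussian up to a third order
  error. Up to \<open>y powr (- 5k/6)\<close> every prime \<open>p \<le> y powr (5/6)\<close> contributes a factor noticeably smaller
  than 1, and Chebyshev's lower bound for the number of primes suffices. For larger \<open>\<bar>\<theta>\<bar>\<close> no
  exponential sums over primes are needed: if \<open>z = exp (\<i> \<theta>)\<close> is not close to 1, then by Bezout at most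
  one prime of a fixed finite set can have \<open>z ^ p\<^sup>k\<close> much closer to 1 than \<open>z\<close>, and every other prime of
  the set saves a factor \<open>t / \<bar>\<theta>\<bar>\<close>. A bounded number of primes thus gives any required power of \<open>t\<close>.
  All estimates are uniform over finite sets of primes, which avoids infinite products in the Fourier
  inversion.
\<close>

section \<open>Fourier inversion for restricted partitions\<close>

text \<open>The exponent 1/(2k+3) measures how much precision the argument may lose. With third
  cumulants of total size y^(3k+1) and variance V, the relative error near zero is y^(3k+1)
  V^(-3/2), and n is at most of order y^(k+1). A variance of exact order y^(2k+1) would give
  y^(-1/2), hence n^(-1/(2k+2)); the claim asks only for y^(-(k+1)/(2k+3)). This slack lets V be
  bounded below by a Chebyshev bound weakened by a small power of y, and lets cumulants be bounded
  above by sums over all positive integers instead of primes, which loses only a logarithm. A second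
  point is that \<rho> is tuned to the series over all primes, so a finite set of primes has the
  wrong mean. The discrepancy is carried along as an explicit error term and disappears when the
  finite sets exhaust the primes.\<close>

definition parts_count :: "nat set \<Rightarrow> nat \<Rightarrow> nat" where
  "parts_count M n = card {X. set_mset X \<subseteq> M \<and> sum_mset X = n}"

text \<open>Excluding the part 0 makes every removal of a part lower the sum, so induction on
  \<open>n\<close> applies. Finiteness is what lets \<open>card\<close> add up in the recurrence
  below.\<close>

lemma finite_multisets_sum:
  fixes M :: "nat set"
  assumes "0 \<notin> M"
  shows "finite {X. set_mset X \<subseteq> M \<and> sum_mset X = n}"
proof (induction n rule: less_induct)
  case (less n)
  have "{X. set_mset X \<subseteq> M \<and> sum_mset X = n}
        \<subseteq> insert {#} (\<Union>m\<in>{1..n}. add_mset m ` {X. set_mset X \<subseteq> M \<and> sum_mset X = n - m})"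
  proof
    fix X assume X: "X \<in> {X. set_mset X \<subseteq> M \<and> sum_mset X = n}"
    show "X \<in> insert {#} (\<Union>m\<in>{1..n}. add_mset m ` {X. set_mset X \<subseteq> M \<and> sum_mset X = n - m})"
    proof (cases X)
      case (add m Y)
      moreover from this X assms have "m \<in> {1..n}"
        by (cases m) auto
      ultimately show ?thesis
        using X by (intro insertI2 UN_I[of m] image_eqI[of _ _ Y]) auto
    qed simp
  qed
  moreover have "finite (insert {#} (\<Union>m\<in>{1..n}. add_mset m ` {X. set_mset X \<subseteq> M \<and> sum_mset X = n - m}))"
    using less by auto
  ultimately show ?case by (rule finite_subset)
qed

lemma parts_count_empty: "parts_count {} n = (if n = 0 then 1 else 0)"
proof -
  have "{X. set_mset X \<subseteq> {} \<and> sum_mset X = n} = (if n = 0 then {{#}} else {})"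
    by auto
  then show ?thesis by (simp add: parts_count_def)
qed

text \<open>Split by whether \<open>m\<close> occurs; removing one copy of \<open>m\<close> is a
  bijection onto the multisets of sum \<open>n - m\<close>. This is (1 - x^m) G_new = G_old read off
  coefficientwise, with G the generating product.\<close>

lemma parts_count_insert:
  assumes "m \<notin> M" "0 \<notin> insert m M"
  shows "parts_count (insert m M) n =
    parts_count M n + (if m \<le> n then parts_count (insert m M) (n - m) else 0)"
proof -
  let ?S = "\<lambda>M n. {X. set_mset X \<subseteq> M \<and> sum_mset X = n}"
  have "?S (insert m M) n = ?S M n \<union> (if m \<le> n then add_mset m ` ?S (insert m M) (n - m) else {})"
    (is "_ = _ \<union> ?T")
  proof (rule set_eqI)
    fix X
    have "X \<in> ?T \<longleftrightarrow> X \<in> ?S (insert m M) n \<and> m \<in># X"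
    proof
      assume "X \<in> ?T"
      then obtain Y where "m \<le> n" "X = add_mset m Y" "set_mset Y \<subseteq> insert m M" "sum_mset Y = n - m"
        by (auto split: if_splits)
      then show "X \<in> ?S (insert m M) n \<and> m \<in># X" by simp
    next
      assume *: "X \<in> ?S (insert m M) n \<and> m \<in># X"
      then obtain Y where Y: "X = add_mset m Y" by (metis multi_member_split)
      with * have "m \<le> n" "Y \<in> ?S (insert m M) (n - m)" by auto
      with Y show "X \<in> ?T" by simp
    qed
    moreover have "X \<in> ?S M n \<longleftrightarrow> X \<in> ?S (insert m M) n \<and> m \<notin># X"
      using assms(1) by blast
    ultimately show "X \<in> ?S (insert m M) n \<longleftrightarrow> X \<in> ?S M n \<union> ?T" by blast
  qed
  moreover have "?S M n \<inter> add_mset m ` ?S (insert m M) (n - m) = {}"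
  proof -
    have "m \<in># X" if "X \<in> add_mset m ` ?S (insert m M) (n - m)" for X
      using that by (elim imageE) simp
    then show ?thesis using assms(1) by blast
  qed
  moreover have "card (add_mset m ` ?S (insert m M) (n - m)) = card (?S (insert m M) (n - m))"
    by (intro card_image) (auto simp: inj_on_def)
  moreover have "finite (?S M n)"
    by (rule finite_multisets_sum) (use assms in auto)
  moreover have "finite (?S (insert m M) (n - m))"
    by (rule finite_multisets_sum) (use assms in auto)
  ultimately show ?thesis
    unfolding parts_count_def by (cases "m \<le> n") (simp_all only: if_True if_False card_Un_disjoint finite_imageI Un_empty_right add_0_right)
qed

text \<open>Cauchy's integral on the circle of radius \<open>r\<close>: 2 pi times the
  \<open>n\<close>-th Taylor coefficient of the product over \<open>M\<close>. The index is an
  integer so that the recurrence can be run below 0, where the coefficients vanish.\<close>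

definition gen_coeff :: "real \<Rightarrow> nat set \<Rightarrow> int \<Rightarrow> complex" where
  "gen_coeff r M n = integral {-pi..pi}
     (\<lambda>\<theta>. (\<Prod>m\<in>M. 1 / (1 - (of_real r * cis \<theta>) ^ m)) * (of_real r * cis \<theta>) powi (- n))"

lemma one_minus_power_nonzero:
  assumes "0 < r" "r < 1" "0 < m"
  shows "1 - (of_real r * cis \<theta>) ^ m \<noteq> 0"
proof
  assume "1 - (of_real r * cis \<theta>) ^ m = 0"
  then have "norm ((of_real r * cis \<theta>) ^ m) = norm (1 :: complex)"
    by (metis eq_iff_diff_eq_0)
  then have "r ^ m = 1" using assms(1) by (simp add: norm_power norm_mult)
  moreover have "r ^ m < 1" using assms by (simp add: power_less_one_iff)
  ultimately show False by simp
qed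

lemma continuous_on_gen_integrand:
  assumes "0 < r" "r < 1" "0 \<notin> M"
  shows "continuous_on S
     (\<lambda>\<theta>. (\<Prod>m\<in>M. 1 / (1 - (of_real r * cis \<theta>) ^ m)) * (of_real r * cis \<theta>) powi (- n))"
proof -
  have "m > 0" if "m \<in> M" for m using that assms(3) by (cases m) auto
  then have "1 - (of_real r * cis \<theta>) ^ m \<noteq> 0" if "m \<in> M" for m \<theta>
    using one_minus_power_nonzero assms(1,2) that by blast
  moreover have "complex_of_real r * cis \<theta> \<noteq> 0" for \<theta>
    using assms by simp
  ultimately show ?thesis
    by (intro continuous_intros) blast+
qed

text \<open>Pointwise in the integrand this is 1 + u/(1 - u) = 1/(1 - u) with u = z^m. Since
  \<open>gen_coeff\<close> and \<open>parts_count\<close> obey the same recurrence, they can be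
  compared without expanding a product of power series.\<close>

lemma gen_coeff_insert:
  assumes "0 < r" "r < 1" "finite M" "m \<notin> M" "0 \<notin> insert m M"
  shows "gen_coeff r (insert m M) n = gen_coeff r M n + gen_coeff r (insert m M) (n - int m)"
proof -
  let ?G = "\<lambda>M \<theta>. \<Prod>m\<in>M. 1 / (1 - (of_real r * cis \<theta>) ^ m)"
  have m: "m > 0" using assms by (cases m) auto
  have "gen_coeff r M n + gen_coeff r (insert m M) (n - int m) = integral {-pi..pi}
    (\<lambda>\<theta>. ?G M \<theta> * (of_real r * cis \<theta>) powi (- n) +
          ?G (insert m M) \<theta> * (of_real r * cis \<theta>) powi (- (n - int m)))"
    unfolding gen_coeff_def
    using assms by (intro integral_add[symmetric] integrable_continuous_interval continuous_on_gen_integrand) auto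
  also have "(\<lambda>\<theta>. ?G M \<theta> * (of_real r * cis \<theta>) powi (- n) +
          ?G (insert m M) \<theta> * (of_real r * cis \<theta>) powi (- (n - int m)))
        = (\<lambda>\<theta>. ?G (insert m M) \<theta> * (of_real r * cis \<theta>) powi (- n))"
  proof
    fix \<theta>
    define z where "z = of_real r * cis \<theta>"
    have z0: "z \<noteq> 0" using assms by (simp add: z_def)
    have nz: "1 - z ^ m \<noteq> 0" unfolding z_def by (rule one_minus_power_nonzero[OF assms(1,2) m])
    have "z powi (- (n - int m)) = z powi (- n) * z ^ m"
      using z0 power_int_add[of z "-n" "int m"] by (simp add: algebra_simps)
    moreover have "?G (insert m M) \<theta> = 1 / (1 - z ^ m) * ?G M \<theta>"
      using assms by (simp add: z_def)
    moreover have "w * P + w * u * (1 / (1 - u) * P) = w * (1 / (1 - u) * P)" if "1 - u \<noteq> 0" for w u P :: complex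
      using that by (simp add: divide_simps) (simp add: algebra_simps)
    from this[OF nz, of "z powi (- n)" "?G M \<theta>"]
    have "?G M \<theta> * z powi (- n) + (1 / (1 - z ^ m) * ?G M \<theta>) * (z powi (- n) * z ^ m)
        = (1 / (1 - z ^ m) * ?G M \<theta>) * z powi (- n)"
      by (simp only: mult_ac)
    ultimately show "?G M \<theta> * (of_real r * cis \<theta>) powi (- n) +
          ?G (insert m M) \<theta> * (of_real r * cis \<theta>) powi (- (n - int m))
          = ?G (insert m M) \<theta> * (of_real r * cis \<theta>) powi (- n)"
      unfolding z_def[symmetric] by metis
  qed
  finally show ?thesis by (simp add: gen_coeff_def)
qed

lemma integral_cis_int:
  assumes "k \<noteq> (0::int)"
  shows "integral {-pi..pi} (\<lambda>\<theta>. cis (of_int k * \<theta>)) = 0"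
proof -
  let ?F = "\<lambda>\<theta>. cis (of_int k * \<theta>) / (of_int k * \<i>)"
  have "((\<lambda>\<theta>. cis (of_int k * \<theta>)) has_integral (?F pi - ?F (-pi))) {-pi..pi}"
  proof (rule fundamental_theorem_of_calculus)
    fix \<theta> :: real
    have "((\<lambda>\<theta>. cis (of_int k * \<theta>)) has_derivative (\<lambda>b. (of_int k * b) *\<^sub>R (\<i> * cis (of_int k * \<theta>)))) (at \<theta> within {-pi..pi})"
      by (intro has_derivative_cis has_derivative_mult_right has_derivative_ident)
    then have "((\<lambda>\<theta>. cis (of_int k * \<theta>)) has_vector_derivative (of_int k * \<i> * cis (of_int k * \<theta>))) (at \<theta> within {-pi..pi})"
      by (simp add: has_vector_derivative_def scaleR_conv_of_real mult_ac)
    from has_vector_derivative_divide[OF this, of "of_int k * \<i>"] assms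
    show "(?F has_vector_derivative cis (of_int k * \<theta>)) (at \<theta> within {-pi..pi})"
      by simp
  qed auto
  moreover have "cis (of_int k * pi) = cis (of_int k * (-pi))"
  proof -
    have "cis (of_int k * pi) = cis (of_int k * (-pi)) * cis (2 * pi * of_int k)"
      by (simp add: cis_mult algebra_simps)
    then show ?thesis by (simp add: cis_multiple_2pi)
  qed
  ultimately show ?thesis by (simp add: integral_unique)
qed

lemma gen_coeff_empty:
  assumes "0 < r"
  shows "gen_coeff r {} n = (if n = 0 then 2 * of_real pi else 0)"
proof (cases "n = 0")
  case True
  then show ?thesis by (simp add: gen_coeff_def scaleR_conv_of_real)
next
  case False
  have "(\<lambda>\<theta>. (of_real r * cis \<theta>) powi (- n)) = (\<lambda>\<theta>. complex_of_real r powi (- n) * cis (of_int (- n) * \<theta>))"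
    by (simp only: power_int_mult_distrib cis_power_int)
  then have "gen_coeff r {} n = complex_of_real r powi (- n) * integral {-pi..pi} (\<lambda>\<theta>. cis (of_int (- n) * \<theta>))"
    by (simp add: gen_coeff_def)
  also have "\<dots> = 0" using integral_cis_int[of "- n"] False by simp
  finally show ?thesis using False by simp
qed

text \<open>For a negative index the recurrence shows that the coefficient is unchanged when \<open>m\<close> is
  subtracted from it, while its size decays along this progression.\<close>

lemma gen_coeff_neg:
  assumes r: "0 < r" "r < 1" and "finite M" "0 \<notin> M" and "n < 0"
  shows "gen_coeff r M n = 0"
  using assms(3-5)
proof (induction M arbitrary: n rule: finite_induct)
  case empty
  then show ?case using r by (simp add: gen_coeff_empty)
next
  case (insert m M)
  have m: "m > 0" using insert by (cases m) auto
  let ?G = "\<lambda>\<theta>. \<Prod>m\<in>insert m M. 1 / (1 - (of_real r * cis \<theta>) ^ m)"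
  have "compact (?G ` {-pi..pi})"
  proof (rule compact_continuous_image)
    show "continuous_on {-pi..pi} ?G"
      using continuous_on_gen_integrand[OF r insert.prems(1), of "{-pi..pi}" 0]
      by (simp only: minus_zero power_int_0_right mult_1_right)
  qed simp
  then have "bounded (?G ` {-pi..pi})" by (rule compact_imp_bounded)
  then obtain B where B: "\<And>\<theta>. \<theta> \<in> {-pi..pi} \<Longrightarrow> norm (?G \<theta>) \<le> B"
    unfolding bounded_iff by blast
  have bound: "norm (gen_coeff r (insert m M) k) \<le> B * r powi (- k) * (pi - (- pi))" for k
    unfolding gen_coeff_def
  proof (rule integral_bound)
    show "continuous_on {-pi..pi} (\<lambda>\<theta>. ?G \<theta> * (of_real r * cis \<theta>) powi (- k))"
      using r insert.prems(1) by (rule continuous_on_gen_integrand)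
    fix \<theta> assume "\<theta> \<in> {-pi..pi}"
    from B[OF this] have "norm (?G \<theta>) * r powi (- k) \<le> B * r powi (- k)"
      by (rule mult_right_mono) (use r in simp)
    moreover have "norm ((of_real r * cis \<theta>) powi (- k)) = r powi (- k)"
      unfolding norm_power_int norm_mult norm_cis using r by simp
    ultimately show "norm (?G \<theta> * (of_real r * cis \<theta>) powi (- k)) \<le> B * r powi (- k)"
      unfolding norm_mult by (simp only:)
  qed auto
  have step: "gen_coeff r (insert m M) n = gen_coeff r (insert m M) (n - int (j * m))" for j
  proof (induction j)
    case (Suc j)
    have 1: "gen_coeff r M (n - int (j * m)) = 0"
    proof (rule insert.IH)
      have "0 \<le> int (j * m)" by (rule of_nat_0_le_iff)
      with insert.prems(2) show "n - int (j * m) < 0" by linarith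
    qed (use insert.prems(1) in blast)
    have 2: "n - int (j * m) - int m = n - int (Suc j * m)" by simp
    have "gen_coeff r (insert m M) (n - int (j * m)) =
        gen_coeff r M (n - int (j * m)) + gen_coeff r (insert m M) (n - int (j * m) - int m)"
      by (rule gen_coeff_insert) fact+
    then show ?case unfolding Suc 1 2 by (simp only: add_0_left)
  qed simp
  have "(\<lambda>j. (r ^ m) ^ j) \<longlonglongrightarrow> 0"
    using r m by (intro LIMSEQ_power_zero) (simp add: power_less_one_iff)
  then have lim: "(\<lambda>j. B * (r powi (- n) * (r ^ m) ^ j) * (pi - (- pi))) \<longlonglongrightarrow> B * (r powi (- n) * 0) * (pi - (-pi))"
    by (intro tendsto_mult_left tendsto_mult_right)
  have "norm (gen_coeff r (insert m M) n) \<le> B * (r powi (- n) * (r ^ m) ^ j) * (pi - (- pi))" for j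
  proof -
    have "r powi (- (n - int (j * m))) = r powi (- n + int (j * m))" by simp
    also have "\<dots> = r powi (- n) * r powi int (j * m)"
      using r by (intro power_int_add) simp
    also have "r powi int (j * m) = (r ^ m) ^ j"
      by (simp only: power_int_of_nat mult.commute[of j] power_mult)
    finally have "r powi (- (n - int (j * m))) = r powi (- n) * (r ^ m) ^ j" .
    then show ?thesis using bound[of "n - int (j * m)"] unfolding step[of j, symmetric] by (simp only:)
  qed
  then have "norm (gen_coeff r (insert m M) n) \<le> B * (r powi (- n) * 0) * (pi - (-pi))"
    by (intro LIMSEQ_le_const[OF lim]) blast
  then show ?case by simp
qed

text \<open>The two recurrences match: the value 0 that \<open>parts_count_insert\<close> supplies
  for \<open>m > n\<close> is the vanishing of \<open>gen_coeff\<close> at negative indices. The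
  outer induction is on \<open>M\<close>, the inner one, strong, on \<open>n\<close>.\<close>

lemma gen_coeff_eq_parts_count:
  assumes r: "0 < r" "r < 1" and "finite M" "0 \<notin> M"
  shows "gen_coeff r M (int n) = 2 * of_real pi * of_nat (parts_count M n)"
  using assms(3-4)
proof (induction M arbitrary: n rule: finite_induct)
  case empty
  then show ?case using r by (simp add: gen_coeff_empty parts_count_empty)
next
  case (insert m M)
  have m: "m > 0" using insert by (cases m) auto
  define c where "c = (\<lambda>n. 2 * complex_of_real pi * of_nat (parts_count (insert m M) n))"
  have "\<forall>n. gen_coeff r (insert m M) (int n) = c n"
  proof (rule allI)
    fix n
    show "gen_coeff r (insert m M) (int n) = c n"
    proof (induction n rule: less_induct)
      case (less n)
      have 1: "gen_coeff r M (int n) = 2 * of_real pi * of_nat (parts_count M n)"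
        using insert.IH insert.prems by blast
      have 2: "gen_coeff r (insert m M) (int n - int m) = (if m \<le> n then c (n - m) else 0)"
      proof (cases "m \<le> n")
        case True
        then show ?thesis using less[of "n - m"] m by (simp add: of_nat_diff)
      next
        case False
        have "gen_coeff r (insert m M) (int n - int m) = 0"
        proof (rule gen_coeff_neg[OF r])
          show "finite (insert m M)" using insert.hyps(1) by simp
        qed (use False insert.prems in auto)
        with False show ?thesis by simp
      qed
      have 3: "parts_count (insert m M) n =
          parts_count M n + (if m \<le> n then parts_count (insert m M) (n - m) else 0)"
        by (rule parts_count_insert) fact+
      have 4: "c n = 2 * of_real pi * of_nat (parts_count M n) + (if m \<le> n then c (n - m) else 0)"
        unfolding c_def by (subst 3) (simp add: distrib_left)
      have "gen_coeff r (insert m M) (int n) = gen_coeff r M (int n) + gen_coeff r (insert m M) (int n - int m)"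
        by (rule gen_coeff_insert) fact+
      then show ?case using 1 2 4 by simp
    qed
  qed
  then show ?case unfolding c_def by simp
qed

section \<open>The characteristic function near zero\<close>

lemma sum_square_geometric:
  fixes q :: real
  assumes "0 \<le> q" "q < 1"
  shows "summable (\<lambda>n. real n ^ 2 * q ^ n)"
    and "(\<Sum>n. real n ^ 2 * q ^ n) \<le> 2 * q / (1 - q) ^ 3"
proof -
  \<comment> \<open>\<open>T n\<close> is the tail of the series starting at \<open>n\<close>.\<close>
  define T where "T = (\<lambda>n. q ^ n * (real n ^ 2 / (1 - q) + 2 * real n * q / (1 - q) ^ 2 + q * (1 + q) / (1 - q) ^ 3))"
  have T: "real n ^ 2 * q ^ n = T n - T (Suc n)" for n
  proof -
    have "1 - q \<noteq> 0" using assms by simp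
    then have "real n ^ 2 = (real n ^ 2 / (1 - q) + 2 * real n * q / (1 - q) ^ 2 + q * (1 + q) / (1 - q) ^ 3)
      - q * ((real n + 1) ^ 2 / (1 - q) + 2 * (real n + 1) * q / (1 - q) ^ 2 + q * (1 + q) / (1 - q) ^ 3)"
      by (simp add: divide_simps) algebra
    then have "q ^ n * real n ^ 2 = q ^ n * ((real n ^ 2 / (1 - q) + 2 * real n * q / (1 - q) ^ 2 + q * (1 + q) / (1 - q) ^ 3)
      - q * ((real n + 1) ^ 2 / (1 - q) + 2 * (real n + 1) * q / (1 - q) ^ 2 + q * (1 + q) / (1 - q) ^ 3))"
      by (simp only:)
    also have "\<dots> = T n - T (Suc n)"
      unfolding T_def power_Suc of_nat_Suc by (simp only: right_diff_distrib mult_ac add_ac)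
    finally show ?thesis by (simp only: mult.commute)
  qed
  have T0: "T n \<ge> 0" for n using assms by (simp add: T_def)
  have le: "(\<Sum>n<N. real n ^ 2 * q ^ n) \<le> T 0" for N
    unfolding T using sum_lessThan_telescope'[of T N] T0[of N] by simp
  then show s: "summable (\<lambda>n. real n ^ 2 * q ^ n)"
    using assms by (intro summableI_nonneg_bounded) auto
  have "(\<Sum>n. real n ^ 2 * q ^ n) \<le> T 0"
    by (intro suminf_le_const s le)
  also have "\<dots> \<le> 2 * q / (1 - q) ^ 3"
    using assms by (simp add: T_def divide_right_mono mult_left_mono algebra_simps mult_left_le)
  finally show "(\<Sum>n. real n ^ 2 * q ^ n) \<le> 2 * q / (1 - q) ^ 3" .
qed

text \<open>The logarithm is expanded as a series in q^n cis (n \<phi>) / n, and each cis (n \<phi>)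
  is replaced by its second order Taylor polynomial. The remainder bound |n \<phi>|^3 / 6 is valid
  for every real \<phi>, however large against 1 - q, and these remainders sum to a multiple of
  \<Sum> n^2 q^n. Only \<open>exp s\<close> is prescribed, so that the logarithms of many factors
  can be added without choosing a branch for the product.\<close>

lemma ln_geometric_quadratic:
  fixes q \<phi> :: real
  assumes "0 \<le> q" "q < 1"
  shows "\<exists>s. exp s = (1 - of_real q) / (1 - of_real q * cis \<phi>) \<and>
    norm (s - \<i> * of_real (\<phi> * q / (1 - q)) + of_real (\<phi>\<^sup>2 / 2 * (q / (1 - q)\<^sup>2)))
      \<le> \<bar>\<phi>\<bar> ^ 3 / 3 * (q / (1 - q) ^ 3)"
proof -
  define s where "s = ln (1 - complex_of_real q) - ln (1 - of_real q * cis \<phi>)"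
  have nw: "norm (of_real q * cis \<phi>) < 1" "norm (complex_of_real q) < 1"
    using assms by (auto simp: norm_mult)
  have ln: "(\<lambda>n. - (w ^ Suc n / of_nat (Suc n))) sums ln (1 - w)" if "norm w < 1" for w :: complex
    using Ln_series'[of "-w"] that
      sums_Suc_iff[of "\<lambda>n. - (w ^ n) / of_nat n" "ln (1 - w)"] by simp
  have nz: "1 - of_real q * cis \<phi> \<noteq> 0" "1 - complex_of_real q \<noteq> 0"
    using nw by (metis less_irrefl norm_one eq_iff_diff_eq_0)+
  have exp: "exp s = (1 - of_real q) / (1 - of_real q * cis \<phi>)"
    unfolding s_def exp_diff using nz by (simp only: exp_Ln not_False_eq_True)
  have 1: "(\<lambda>n. - (complex_of_real q ^ Suc n / of_nat (Suc n)) - - ((of_real q * cis \<phi>) ^ Suc n / of_nat (Suc n))) sums s"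
    unfolding s_def by (intro sums_diff ln nw)
  have "(\<lambda>n. \<phi> * (q * q ^ n)) sums (\<phi> * (q * (1 / (1 - q))))"
    using assms by (intro sums_mult geometric_sums) auto
  then have 2: "(\<lambda>n. \<i> * of_real (\<phi> * q ^ Suc n)) sums (\<i> * of_real (\<phi> * q / (1 - q)))"
    by (intro sums_mult sums_of_real) simp
  have "(\<lambda>n. q * (real (Suc n) * q ^ n)) sums (q * (1 / (1 - q)\<^sup>2))"
    using assms by (intro sums_mult geometric_deriv_sums) auto
  then have 3: "(\<lambda>n. of_real (\<phi>\<^sup>2 / 2 * (q * (real (Suc n) * q ^ n)))) sums complex_of_real (\<phi>\<^sup>2 / 2 * (q / (1 - q)\<^sup>2))"
    by (intro sums_of_real sums_mult) simp
  define t where "t = (\<lambda>n. of_real (q ^ n / n) * (cis (n * \<phi>) - 1 - \<i> * of_real (n * \<phi>) + of_real ((n * \<phi>)\<^sup>2 / 2)))"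
  have t: "(\<lambda>n. t (Suc n)) sums (s - \<i> * of_real (\<phi> * q / (1 - q)) + of_real (\<phi>\<^sup>2 / 2 * (q / (1 - q)\<^sup>2)))"
  proof -
    have "- (complex_of_real q ^ Suc n / of_nat (Suc n)) - - ((of_real q * cis \<phi>) ^ Suc n / of_nat (Suc n))
        - \<i> * of_real (\<phi> * q ^ Suc n) + of_real (\<phi>\<^sup>2 / 2 * (q * (real (Suc n) * q ^ n))) = t (Suc n)" for n
    proof -
      define N where "N = complex_of_nat (Suc n)"
      define Q where "Q = complex_of_real q ^ Suc n"
      define C where "C = cis (real (Suc n) * \<phi>)"
      have N: "N \<noteq> 0" unfolding N_def by (simp only: of_nat_eq_0_iff)
      have a: "(of_real q * cis \<phi>) ^ Suc n = Q * C"
        by (simp only: power_mult_distrib Q_def C_def Complex.DeMoivre)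
      have b: "complex_of_real (\<phi> * q ^ Suc n) = of_real \<phi> * Q" by (simp add: Q_def)
      have c: "complex_of_real (\<phi>\<^sup>2 / 2 * (q * (real (Suc n) * q ^ n))) = of_real \<phi> ^ 2 / 2 * N * Q"
        by (simp add: N_def Q_def)
      have d: "t (Suc n) = Q / N * (C - 1 - \<i> * (N * of_real \<phi>) + (N * of_real \<phi>)\<^sup>2 / 2)"
        by (simp add: t_def N_def Q_def C_def)
      show ?thesis unfolding a b c d Q_def[symmetric] N_def[symmetric]
        using N by (simp add: divide_simps power2_eq_square algebra_simps)
    qed
    then show ?thesis
      using sums_add[OF sums_diff[OF 1 2] 3] by simp
  qed
  have tb: "norm (t n) \<le> \<bar>\<phi>\<bar> ^ 3 / 6 * (real n ^ 2 * q ^ n)" for n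
  proof (cases "n = 0")
    case False
    have "norm (cis (n * \<phi>) - 1 - \<i> * of_real (n * \<phi>) + of_real ((n * \<phi>)\<^sup>2 / 2)) \<le> \<bar>n * \<phi>\<bar> ^ 3 / 6"
      using iexp_approx1[of "n * \<phi>" 2]
      by (simp add: numeral_2_eq_2 numeral_3_eq_3 fact_numeral cis_conv_exp diff_diff_eq power_mult_distrib algebra_simps)
    then have "norm (t n) \<le> q ^ n / n * (\<bar>n * \<phi>\<bar> ^ 3 / 6)"
      unfolding t_def norm_mult norm_of_real using assms by (intro mult_mono) auto
    also have "\<dots> = \<bar>\<phi>\<bar> ^ 3 / 6 * (real n ^ 2 * q ^ n)"
      using False by (simp add: abs_mult power_mult_distrib power3_eq_cube power2_eq_square)
    finally show ?thesis .
  qed (simp add: t_def)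
  note sq = sum_square_geometric[OF assms]
  have "norm (s - \<i> * of_real (\<phi> * q / (1 - q)) + of_real (\<phi>\<^sup>2 / 2 * (q / (1 - q)\<^sup>2))) = norm (\<Sum>n. t (Suc n))"
    using t by (simp add: sums_iff)
  also have "\<dots> \<le> (\<Sum>n. \<bar>\<phi>\<bar> ^ 3 / 6 * (real (Suc n) ^ 2 * q ^ Suc n))"
  proof (rule norm_suminf_le)
    have "summable (\<lambda>n. real (Suc n) ^ 2 * q ^ Suc n)"
      using sq(1) by (subst summable_Suc_iff)
    then show "summable (\<lambda>n. \<bar>\<phi>\<bar> ^ 3 / 6 * (real (Suc n) ^ 2 * q ^ Suc n))"
      by (rule summable_mult)
  qed (rule tb)
  also have "\<dots> = \<bar>\<phi>\<bar> ^ 3 / 6 * (\<Sum>n. real (Suc n) ^ 2 * q ^ Suc n)"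
    using sq(1) by (intro suminf_mult) (subst summable_Suc_iff)
  also have "(\<Sum>n. real (Suc n) ^ 2 * q ^ Suc n) = (\<Sum>n. real n ^ 2 * q ^ n)"
    using suminf_split_head[OF sq(1)] by simp
  also have "\<bar>\<phi>\<bar> ^ 3 / 6 * \<dots> \<le> \<bar>\<phi>\<bar> ^ 3 / 6 * (2 * q / (1 - q) ^ 3)"
    using sq(2) by (intro mult_left_mono) auto
  finally show ?thesis using exp by (intro exI[of _ s]) (simp add: field_simps)
qed

definition geo_char :: "real \<Rightarrow> nat \<Rightarrow> real \<Rightarrow> complex" where
  "geo_char r m \<theta> = (1 - of_real (r ^ m)) / (1 - of_real (r ^ m) * cis (real m * \<theta>))"

text \<open>For \<open>i = 1, 2\<close> this is the mean and the variance of \<open>m\<close> times a geometric random variable with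
  parameter \<open>r\<^sup>m\<close>, whose characteristic function is \<^const>\<open>geo_char\<close>; for \<open>i = 3\<close> it is, up to a
  factor 2, a bound for the third cumulant.\<close>

definition cum :: "nat \<Rightarrow> real \<Rightarrow> nat \<Rightarrow> real" where
  "cum i r m = real m ^ i * r ^ m / (1 - r ^ m) ^ i"

lemma norm_exp_minus_one: "norm (exp w - 1) \<le> norm w * exp (norm w)" for w :: complex
  using Taylor_exp_field[of w 0] by (simp add: mult.commute)

text \<open>Adding the logarithms of the factors leaves an exponent that differs from the Gaussian
  one by some w with |w| \<le> K |\<theta>|^3 / 3 \<le> 1/3. Then |exp w - 1| \<le> 3 |w|, which
  absorbs the 1/3. The error is multiplicative, so it keeps the Gaussian factor and can be
  integrated over the whole line.\<close>

lemma prod_geo_char_approx: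
  assumes r: "0 < r" "r < 1" and M: "finite M" "0 \<notin> M"
    and K: "(\<Sum>m\<in>M. cum 3 r m) \<le> K" "K * \<bar>\<theta>\<bar> ^ 3 \<le> 1"
  defines "\<mu> \<equiv> (\<Sum>m\<in>M. cum 1 r m)" and "V \<equiv> (\<Sum>m\<in>M. cum 2 r m)"
  shows "norm ((\<Prod>m\<in>M. geo_char r m \<theta>) * cis (- (\<mu> * \<theta>)) - of_real (exp (- (V * \<theta>\<^sup>2 / 2))))
      \<le> K * \<bar>\<theta>\<bar> ^ 3 * exp (- (V * \<theta>\<^sup>2 / 2))"
proof -
  have q: "0 \<le> r ^ m" "r ^ m < 1" if "m \<in> M" for m
    using r M(2) that by (auto simp: power_less_one_iff intro: gr0I)
  have "\<forall>m\<in>M. \<exists>s. exp s = geo_char r m \<theta> \<and>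
    norm (s - \<i> * of_real (cum 1 r m * \<theta>) + of_real (cum 2 r m * (\<theta>\<^sup>2 / 2))) \<le> \<bar>\<theta>\<bar> ^ 3 / 3 * cum 3 r m"
  proof
    fix m assume m: "m \<in> M"
    have e: "m * \<theta> * r ^ m / (1 - r ^ m) = cum 1 r m * \<theta>"
      "(m * \<theta>)\<^sup>2 / 2 * (r ^ m / (1 - r ^ m)\<^sup>2) = cum 2 r m * (\<theta>\<^sup>2 / 2)"
      "\<bar>m * \<theta>\<bar> ^ 3 / 3 * (r ^ m / (1 - r ^ m) ^ 3) = \<bar>\<theta>\<bar> ^ 3 / 3 * cum 3 r m"
      by (simp_all add: cum_def power_mult_distrib abs_mult mult_ac)
    show "\<exists>s. exp s = geo_char r m \<theta> \<and>
      norm (s - \<i> * of_real (cum 1 r m * \<theta>) + of_real (cum 2 r m * (\<theta>\<^sup>2 / 2))) \<le> \<bar>\<theta>\<bar> ^ 3 / 3 * cum 3 r m"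
      using ln_geometric_quadratic[OF q[OF m], of "m * \<theta>"] unfolding e geo_char_def .
  qed
  then obtain s where s: "\<And>m. m \<in> M \<Longrightarrow> exp (s m) = geo_char r m \<theta>"
    "\<And>m. m \<in> M \<Longrightarrow> norm (s m - \<i> * of_real (cum 1 r m * \<theta>) + of_real (cum 2 r m * (\<theta>\<^sup>2 / 2))) \<le> \<bar>\<theta>\<bar> ^ 3 / 3 * cum 3 r m"
    by metis
  define w where "w = (\<Sum>m\<in>M. s m - \<i> * of_real (cum 1 r m * \<theta>) + of_real (cum 2 r m * (\<theta>\<^sup>2 / 2)))"
  have w: "w = (\<Sum>m\<in>M. s m) - \<i> * of_real (\<mu> * \<theta>) + of_real (V * \<theta>\<^sup>2 / 2)"
    by (simp add: w_def sum.distrib sum_subtractf \<mu>_def V_def sum_distrib_left sum_distrib_right)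
  have "norm w \<le> (\<Sum>m\<in>M. \<bar>\<theta>\<bar> ^ 3 / 3 * cum 3 r m)"
    unfolding w_def by (intro sum_norm_le s(2))
  also have "\<dots> = \<bar>\<theta>\<bar> ^ 3 / 3 * (\<Sum>m\<in>M. cum 3 r m)" by (simp add: sum_distrib_left)
  also have "\<dots> \<le> \<bar>\<theta>\<bar> ^ 3 / 3 * K" using K(1) by (intro mult_left_mono) auto
  finally have nw: "norm w \<le> K * \<bar>\<theta>\<bar> ^ 3 / 3" by (simp add: mult.commute)
  have K0: "0 \<le> K * \<bar>\<theta>\<bar> ^ 3" using nw norm_ge_zero[of w] by linarith
  have "norm w \<le> 1 / 3" using nw K(2) by linarith
  have "norm (exp w - 1) \<le> norm w * exp (norm w)" by (rule norm_exp_minus_one)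
  also have "\<dots> \<le> (K * \<bar>\<theta>\<bar> ^ 3 / 3) * 3"
  proof (intro mult_mono nw)
    have "exp (norm w) \<le> exp 1" using \<open>norm w \<le> 1 / 3\<close> by simp
    also have "exp (1::real) \<le> 3" by (rule exp_le)
    finally show "exp (norm w) \<le> 3" .
  qed (use K0 in auto)
  finally have e: "norm (exp w - 1) \<le> K * \<bar>\<theta>\<bar> ^ 3" by simp
  have "(\<Prod>m\<in>M. geo_char r m \<theta>) = exp (\<Sum>m\<in>M. s m)"
    using M(1) by (simp add: exp_sum s(1))
  also have "(\<Sum>m\<in>M. s m) = w + \<i> * of_real (\<mu> * \<theta>) - of_real (V * \<theta>\<^sup>2 / 2)"
    unfolding w by simp
  also have "exp \<dots> * cis (- (\<mu> * \<theta>)) = exp w * exp (- complex_of_real (V * \<theta>\<^sup>2 / 2))"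
    unfolding cis_conv_exp mult_exp_exp by (simp add: algebra_simps)
  also have "exp (- complex_of_real (V * \<theta>\<^sup>2 / 2)) = of_real (exp (- (V * \<theta>\<^sup>2 / 2)))"
    by (simp only: exp_of_real[symmetric] of_real_minus)
  finally have "(\<Prod>m\<in>M. geo_char r m \<theta>) * cis (- (\<mu> * \<theta>)) - of_real (exp (- (V * \<theta>\<^sup>2 / 2)))
     = (exp w - 1) * of_real (exp (- (V * \<theta>\<^sup>2 / 2)))"
    by (simp only: left_diff_distrib mult_1_left)
  then have "norm ((\<Prod>m\<in>M. geo_char r m \<theta>) * cis (- (\<mu> * \<theta>)) - of_real (exp (- (V * \<theta>\<^sup>2 / 2)))) =
     norm (exp w - 1) * exp (- (V * \<theta>\<^sup>2 / 2))"
    by (simp only: norm_mult norm_of_real abs_exp_cancel)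
  also have "\<dots> \<le> K * \<bar>\<theta>\<bar> ^ 3 * exp (- (V * \<theta>\<^sup>2 / 2))"
    using e by (intro mult_right_mono) auto
  finally show ?thesis .
qed

section \<open>Comparison with the Gaussian integral\<close>

text \<open>These are moments of the normal density of variance 1/V, rescaled. The third absolute
  moment is the price of an error that is cubic in \<theta>.\<close>

lemma gaussian_moments:
  assumes "V > 0"
  shows "has_bochner_integral lborel (\<lambda>x. exp (- (V * x\<^sup>2 / 2))) (sqrt (2 * pi / V))"
    and "has_bochner_integral lborel (\<lambda>x. \<bar>x\<bar> ^ 3 * exp (- (V * x\<^sup>2 / 2))) (4 / V\<^sup>2)"
proof -
  define \<sigma> where "\<sigma> = 1 / sqrt V"
  have \<sigma>: "\<sigma> > 0" "\<sigma>\<^sup>2 = 1 / V" using assms by (auto simp: \<sigma>_def power_divide)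
  have *: "exp (- (V * x\<^sup>2 / 2)) = normal_density 0 \<sigma> x * sqrt (2 * pi / V)" for x
    unfolding normal_density_def \<sigma> using assms by (simp add: field_simps real_sqrt_divide)
  have "has_bochner_integral lborel (\<lambda>x. normal_density 0 \<sigma> x * sqrt (2 * pi / V)) (1 * sqrt (2 * pi / V))"
    using \<sigma>(1) integrable_normal_density integral_normal_density
    by (intro has_bochner_integral_mult_left) (auto simp: has_bochner_integral_iff)
  then show "has_bochner_integral lborel (\<lambda>x. exp (- (V * x\<^sup>2 / 2))) (sqrt (2 * pi / V))"
    unfolding * by simp
  have "has_bochner_integral lborel (\<lambda>x. (normal_density 0 \<sigma> x * \<bar>x - 0\<bar> ^ (2 * 1 + 1)) * sqrt (2 * pi / V))
     ((2 ^ 1 * \<sigma> ^ (2 * 1 + 1) * fact 1 * sqrt (2 / pi)) * sqrt (2 * pi / V))"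
    by (intro has_bochner_integral_mult_left normal_moment_abs_odd \<sigma>)
  moreover have "(2 ^ 1 * \<sigma> ^ (2 * 1 + 1) * fact 1 * sqrt (2 / pi)) * sqrt (2 * pi / V) = 4 / V\<^sup>2"
  proof -
    have "sqrt (2 / pi) * sqrt (2 * pi / V) = sqrt (4 / V)"
      by (simp add: real_sqrt_mult[symmetric])
    also have "\<dots> = 2 * \<sigma>" by (simp add: \<sigma>_def real_sqrt_divide)
    finally have "(2 ^ 1 * \<sigma> ^ (2 * 1 + 1) * fact 1 * sqrt (2 / pi)) * sqrt (2 * pi / V) = 4 * (\<sigma>\<^sup>2)\<^sup>2"
      by (simp add: power_numeral_reduce)
    then show ?thesis by (simp add: \<sigma> power_divide)
  qed
  ultimately show "has_bochner_integral lborel (\<lambda>x. \<bar>x\<bar> ^ 3 * exp (- (V * x\<^sup>2 / 2))) (4 / V\<^sup>2)"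
    unfolding * by (simp add: mult_ac)
qed

text \<open>One majorant \<open>?h\<close> serves all ranges. In the far range, and outside
  [-pi, pi] because K \<ge> 1, the factor K |\<theta>|^3 is at least 1, so the Gaussian tail is
  itself dominated by the cubic error term and is paid for by the same third moment.\<close>

lemma gaussian_comparison:
  fixes f :: "real \<Rightarrow> complex"
  assumes V: "V > 0" and K: "K \<ge> 1" and f: "continuous_on {-pi..pi} f"
    and near: "\<And>\<theta>. \<bar>\<theta>\<bar> \<le> pi \<Longrightarrow> K * \<bar>\<theta>\<bar> ^ 3 \<le> 1 \<Longrightarrow>
      norm (f \<theta> - of_real (exp (- (V * \<theta>\<^sup>2 / 2)))) \<le> K * \<bar>\<theta>\<bar> ^ 3 * exp (- (V * \<theta>\<^sup>2 / 2))"
    and far: "\<And>\<theta>. \<bar>\<theta>\<bar> \<le> pi \<Longrightarrow> K * \<bar>\<theta>\<bar> ^ 3 \<ge> 1 \<Longrightarrow> norm (f \<theta>) \<le> \<epsilon>"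
  shows "norm (integral {-pi..pi} f - of_real (sqrt (2 * pi / V))) \<le> 4 * K / V\<^sup>2 + 2 * pi * \<epsilon>"
proof -
  let ?g = "\<lambda>\<theta>. exp (- (V * \<theta>\<^sup>2 / 2))"
  let ?h = "\<lambda>\<theta>. K * (\<bar>\<theta>\<bar> ^ 3 * ?g \<theta>) + \<epsilon> * indicator {-pi..pi} \<theta>"
  \<comment> \<open>The endpoint pi already lies in the far range, so \<open>\<epsilon>\<close>
    bounds a norm.\<close>
  have \<epsilon>: "\<epsilon> \<ge> 0"
  proof -
    have "1 * 1 \<le> K * \<bar>pi\<bar> ^ 3"
      using K pi_ge_two by (intro mult_mono one_le_power) auto
    then have "norm (f pi) \<le> \<epsilon>" using far[of pi] by simp
    then show ?thesis using norm_ge_zero[of "f pi"] by linarith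
  qed
  note g = gaussian_moments(1)[OF V] and h = gaussian_moments(2)[OF V]
  have fi: "set_integrable lborel {-pi..pi} f"
    by (rule borel_integrable_atLeastAtMost') (rule f)
  have fint: "(LINT \<theta>:{-pi..pi}|lborel. f \<theta>) = integral {-pi..pi} f"
    by (rule set_borel_integral_eq_integral(2)[OF fi])
  have gi: "has_bochner_integral lborel (\<lambda>\<theta>. complex_of_real (?g \<theta>)) (of_real (sqrt (2 * pi / V)))"
    using has_bochner_integral_of_real[OF g] .
  have hi: "has_bochner_integral lborel ?h (K * (4 / V\<^sup>2) + \<epsilon> * (2 * pi))"
  proof (intro has_bochner_integral_add has_bochner_integral_mult_right h)
    show "has_bochner_integral lborel (indicator {- pi..pi} :: real \<Rightarrow> real) (2 * pi)"
      using has_bochner_integral_real_indicator[of "{-pi..pi}" lborel] by simp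
  qed
  have eq: "integral {-pi..pi} f - of_real (sqrt (2 * pi / V)) =
      (LINT \<theta>|lborel. indicator {-pi..pi} \<theta> *\<^sub>R f \<theta> - complex_of_real (?g \<theta>))"
    using fi gi unfolding fint[symmetric] set_integrable_def set_lebesgue_integral_def has_bochner_integral_iff
    by (subst Bochner_Integration.integral_diff) auto
  have "norm (LINT \<theta>|lborel. indicator {-pi..pi} \<theta> *\<^sub>R f \<theta> - complex_of_real (?g \<theta>))
      \<le> (LINT \<theta>|lborel. ?h \<theta>)"
  proof (rule Bochner_Integration.integral_norm_bound_integral)
    show "integrable lborel (\<lambda>\<theta>. indicator {-pi..pi} \<theta> *\<^sub>R f \<theta> - complex_of_real (?g \<theta>))"
      using fi gi by (auto simp: set_integrable_def has_bochner_integral_iff)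
    show "integrable lborel ?h" using hi by (simp add: has_bochner_integral_iff)
    fix \<theta> :: real
    consider "\<bar>\<theta>\<bar> \<le> pi" "K * \<bar>\<theta>\<bar> ^ 3 \<le> 1" | "\<bar>\<theta>\<bar> \<le> pi" "K * \<bar>\<theta>\<bar> ^ 3 \<ge> 1" | "\<bar>\<theta>\<bar> > pi" by linarith
    then show "norm (indicator {-pi..pi} \<theta> *\<^sub>R f \<theta> - complex_of_real (?g \<theta>)) \<le> ?h \<theta>"
    proof cases
      case 1
      then have "\<theta> \<in> {-pi..pi}" by auto
      then show ?thesis using near[OF 1] \<epsilon> by (simp add: mult.assoc)
    next
      case 2
      then have in': "\<theta> \<in> {-pi..pi}" by auto
      have "norm (f \<theta> - complex_of_real (?g \<theta>)) \<le> norm (f \<theta>) + norm (complex_of_real (?g \<theta>))"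
        by (rule norm_triangle_ineq4)
      also have "\<dots> \<le> \<epsilon> + ?g \<theta>" using far[OF 2] by simp
      finally have "norm (f \<theta> - complex_of_real (?g \<theta>)) \<le> \<epsilon> + ?g \<theta>" .
      moreover have "1 * ?g \<theta> \<le> K * \<bar>\<theta>\<bar> ^ 3 * ?g \<theta>"
        using 2(2) by (intro mult_right_mono) auto
      ultimately have "norm (f \<theta> - complex_of_real (?g \<theta>)) \<le> \<epsilon> + K * \<bar>\<theta>\<bar> ^ 3 * ?g \<theta>"
        by linarith
      then show ?thesis using in' by (simp add: mult.assoc add.commute)
    next
      case 3
      have out: "\<theta> \<notin> {-pi..pi}" using 3 by auto
      have "1 \<le> \<bar>\<theta>\<bar>" using 3 pi_ge_two by linarith
      then have "1 \<le> \<bar>\<theta>\<bar> ^ 3" by (rule one_le_power)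
      with K have "1 * 1 \<le> K * \<bar>\<theta>\<bar> ^ 3" by (rule mult_mono) (use K in auto)
      then have "1 * ?g \<theta> \<le> K * \<bar>\<theta>\<bar> ^ 3 * ?g \<theta>"
        by (intro mult_right_mono) auto
      with out show ?thesis by (simp add: mult.assoc)
    qed
  qed
  also have "\<dots> = 4 * K / V\<^sup>2 + 2 * pi * \<epsilon>"
    using hi by (simp add: has_bochner_integral_iff)
  finally show ?thesis unfolding eq .
qed

section \<open>Chebyshev's lower bound\<close>

text \<open>The numbers \<open>1 / ((n + 1) (n choose k))\<close> form Leibniz's harmonic triangle, hence are integer
  combinations of unit fractions.\<close>

lemma Ints_leibniz_harmonic:
  fixes D :: real
  assumes "\<And>j. 1 \<le> j \<Longrightarrow> j \<le> N \<Longrightarrow> D / real j \<in> \<int>" and "k \<le> n" "n < N"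
  shows "D / (real (n + 1) * real (n choose k)) \<in> \<int>"
  using assms(2,3)
proof (induction k arbitrary: n)
  case 0
  then show ?case using assms(1)[of "n + 1"] by simp
next
  case (Suc k)
  then obtain m where n: "n = Suc m" "k \<le> m" by (cases n) auto
  \<comment> \<open>The rule of the triangle: an entry is the one above it to the left minus its
    left neighbour.\<close>
  have "D / (real (m + 1) * real (m choose k)) - D / (real (n + 1) * real (n choose k)) \<in> \<int>"
    using Suc n by (intro Ints_diff Suc.IH) auto
  also have "D / (real (m + 1) * real (m choose k)) - D / (real (n + 1) * real (n choose k))
      = D / (real (n + 1) * real (n choose Suc k))"
  proof -
    define a b c where "a = real (m choose k)" "b = real (n choose k)" "c = real (n choose Suc k)"
    have pos: "a > 0" "b > 0" "c > 0" using n Suc.prems by (auto simp: a_b_c_def simp del: binomial_Suc_Suc intro!: zero_less_binomial)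
    have "real (Suc k * (n choose Suc k)) = real (Suc m * (m choose k))"
      unfolding n(1) Suc_times_binomial ..
    then have c: "c = real (m + 1) * a / real (k + 1)"
      by (simp add: a_b_c_def field_simps)
    have "real ((n - k) * (n choose k)) = real (n * ((n - 1) choose k))"
      unfolding binomial_absorb_comp ..
    then have b: "b = real (m + 1) * a / (real (m + 1) - real k)"
      using n by (simp add: a_b_c_def of_nat_diff field_simps)
    have "real (m + 1) - real k > 0" "real (k + 1) > 0" "real m + 1 > 0" "real m + 2 > 0" using n by auto
    then show ?thesis
      unfolding a_b_c_def[symmetric] b c unfolding n(1) using pos(1) by (simp add: divide_simps) algebra
  qed
  finally show ?case .
qed

text \<open>By the harmonic triangle, N (N - 1 choose k) divides \<open>D\<close> for every k. Row N
  - 1 of Pascal's triangle has N entries with sum 2^(N-1), so some entry is at least 2^(N-1) /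
  N.\<close>

lemma two_power_le_common_multiple:
  assumes "N \<ge> 1" "D > 0" and dvd: "\<And>j. 1 \<le> j \<Longrightarrow> j \<le> N \<Longrightarrow> j dvd D"
  shows "2 ^ (N - 1) \<le> (D :: nat)"
proof -
  have "\<exists>k\<le>N - 1. 2 ^ (N - 1) \<le> N * ((N - 1) choose k)"
  proof (rule ccontr)
    assume "\<not> ?thesis"
    then have "(\<Sum>k\<le>N - 1. N * ((N - 1) choose k)) < (\<Sum>k\<le>N - 1. 2 ^ (N - 1))"
      by (intro sum_strict_mono) auto
    also have "(\<Sum>k\<le>N - 1. N * ((N - 1) choose k)) = N * 2 ^ (N - 1)"
      by (simp only: sum_distrib_left[symmetric] choose_row_sum)
    finally show False using assms(1) by simp
  qed
  then obtain k where k: "k \<le> N - 1" "2 ^ (N - 1) \<le> N * ((N - 1) choose k)" by blast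
  define x where "x = real D / (real (N - 1 + 1) * real ((N - 1) choose k))"
  have "x \<in> \<int>" unfolding x_def
  proof (rule Ints_leibniz_harmonic[where N = N])
    show "real D / real j \<in> \<int>" if j: "1 \<le> j" "j \<le> N" for j
    proof -
      from dvd[OF j] obtain c where "D = j * c" ..
      then show ?thesis using j by simp
    qed
  qed (use k assms in auto)
  moreover have "x > 0" using assms k by (simp add: x_def)
  ultimately have "x \<ge> 1" by (metis Ints_cases of_int_0_less_iff of_int_1_le_iff int_one_le_iff_zero_less)
  then have "real (N * ((N - 1) choose k)) \<le> real D"
    using assms(1) k(1) by (simp add: x_def field_simps)
  then show ?thesis using k(2) by linarith
qed

text \<open>The least common multiple of 1, ..., N is a product of maximal prime powers p^(e p)
  \<le> N, so each prime up to N contributes a factor of at most N.\<close>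

lemma two_power_le_power_card_primes:
  assumes "N \<ge> 1"
  shows "2 ^ (N - 1) \<le> N ^ card {p. prime p \<and> p \<le> N}"
proof -
  let ?P = "{p. prime p \<and> p \<le> N}"
  define e where "e p = Max {i. p ^ i \<le> N}" for p
  have fin: "finite {i. p ^ i \<le> N}" if "prime p" for p
  proof (rule finite_subset)
    show "{i. p ^ i \<le> N} \<subseteq> {..N}"
    proof
      fix i assume "i \<in> {i. p ^ i \<le> N}"
      moreover have "i < p ^ i" using that prime_gt_1_nat by (intro power_gt_expt) simp
      ultimately show "i \<in> {..N}" by simp
    qed
  qed simp
  have finP: "finite ?P" by simp
  have e_le: "p ^ e p \<le> N" if "prime p" for p
  proof -
    have "e p \<in> {i. p ^ i \<le> N}"
      unfolding e_def using fin[OF that] assms by (intro Max_in) (auto intro: exI[of _ 0])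
    then show ?thesis by simp
  qed
  define D where "D = (\<Prod>p\<in>?P. p ^ e p)"
  have "2 ^ (N - 1) \<le> D"
  proof (rule two_power_le_common_multiple)
    show "D > 0" unfolding D_def by (intro prod_pos) (auto simp: prime_gt_0_nat)
    fix j assume j: "1 \<le> j" "j \<le> N"
    have "j = (\<Prod>p\<in>prime_factors j. p ^ multiplicity p j)"
      using j by (intro prime_factorization_nat) auto
    also have "\<dots> dvd (\<Prod>p\<in>prime_factors j. p ^ e p)"
    proof (intro prod_dvd_prod le_imp_power_dvd)
      fix p assume p: "p \<in> prime_factors j"
      then have "p ^ multiplicity p j \<le> j"
        using j multiplicity_dvd[of p j] by (intro dvd_imp_le) auto
      then show "multiplicity p j \<le> e p"
        unfolding e_def using fin[of p] p j by (intro Max_ge) auto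
    qed
    also have "\<dots> dvd D"
      unfolding D_def using j by (intro prod_dvd_prod_subset finP) (auto dest: dvd_imp_le simp: prime_factors_dvd)
    finally show "j dvd D" .
  qed (use assms in auto)
  also have "D \<le> (\<Prod>p\<in>?P. N)" unfolding D_def by (intro prod_mono) (auto intro: e_le)
  finally show ?thesis by simp
qed

text \<open>Taking logarithms gives (N - 1) ln 2 \<le> \<pi>(N) ln N. The logarithm on the right is
  traded for x^\<delta> / \<delta>, and N - 1 \<ge> x/4 for x \<ge> 2; this is the origin of the
  constant.\<close>

lemma prime_count_lower:
  fixes \<delta> :: real
  assumes "\<delta> > 0"
  obtains c where "c > 0" "\<And>x. x \<ge> 2 \<Longrightarrow> c * x powr (1 - \<delta>) \<le> real (card {p. prime p \<and> real p \<le> x})"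
proof
  show "\<delta> * ln 2 / 4 > 0" using assms by simp
  fix x :: real assume x: "x \<ge> 2"
  define N where "N = nat \<lfloor>x\<rfloor>"
  define C where "C = real (card {p. prime p \<and> real p \<le> x})"
  have N: "N \<ge> 2" "real N \<le> x" "x < real N + 1" unfolding N_def using x by linarith+
  have "{p. prime p \<and> real p \<le> x} = {p. prime p \<and> p \<le> N}"
    unfolding N_def using x by (auto simp: le_nat_floor) linarith
  then have "real (2 ^ (N - 1)) \<le> real (N ^ card {p. prime p \<and> real p \<le> x})"
    using two_power_le_power_card_primes[of N] N by (simp only: of_nat_le_iff)
  then have "ln (real (2 ^ (N - 1))) \<le> ln (real (N ^ card {p. prime p \<and> real p \<le> x}))"
    using N by (subst ln_le_cancel_iff) auto
  then have "real (N - 1) * ln 2 \<le> C * ln (real N)"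
    using N by (simp add: ln_realpow C_def)
  also have "\<dots> \<le> C * (x powr \<delta> / \<delta>)"
  proof (rule mult_left_mono)
    have "ln (real N) \<le> ln x" using N x by simp
    also have "\<dots> \<le> x powr \<delta> / \<delta>" using x assms by (intro ln_powr_bound) auto
    finally show "ln (real N) \<le> x powr \<delta> / \<delta>" .
  qed (simp add: C_def)
  finally have 1: "real (N - 1) * ln 2 \<le> C * (x powr \<delta> / \<delta>)" .
  have "x / 4 * ln 2 \<le> real (N - 1) * ln 2"
  proof (rule mult_right_mono)
    have "real N \<ge> 2" using N(1) by simp
    then show "x / 4 \<le> real (N - 1)" using N by (simp add: of_nat_diff)
  qed simp
  with 1 have "x / 4 * ln 2 \<le> C * (x powr \<delta> / \<delta>)" by linarith
  then have "\<delta> * ln 2 / 4 * x \<le> C * x powr \<delta>" using assms by (simp add: field_simps)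
  then have "\<delta> * ln 2 / 4 * x / x powr \<delta> \<le> C" using x by (simp add: field_simps)
  moreover have "x powr (1 - \<delta>) = x / x powr \<delta>" using x by (simp add: powr_diff)
  ultimately show "\<delta> * ln 2 / 4 * x powr (1 - \<delta>) \<le> C" by simp
qed

section \<open>Size of the cumulants\<close>

lemma power_over_fact_le_exp:
  fixes x :: real
  assumes "x \<ge> 0"
  shows "x ^ n / fact n \<le> exp x"
proof -
  have "(\<Sum>i\<in>{n}. x ^ i /\<^sub>R fact i) \<le> (\<Sum>i. x ^ i /\<^sub>R fact i)"
    using assms by (intro sum_le_suminf summable_exp_generic) auto
  then show ?thesis by (simp add: exp_def divide_inverse mult.commute)
qed

text \<open>Bounding 1 + x^2 by (1 + x)^2 leaves (1 + x)^5 \<le> 5! exp (1 + x), and 360 is 5! times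
  3 \<ge> e. The quadratic decay is chosen because its sum can be compared with an
  arctangent.\<close>

lemma exp_cubic_bound:
  fixes x :: real
  assumes "x \<ge> 0"
  shows "exp (- x) * (1 + x) ^ 3 \<le> 360 / (1 + x\<^sup>2)"
proof -
  have "(1 + x) ^ 3 * (1 + x\<^sup>2) \<le> (1 + x) ^ 3 * (1 + x) ^ 2"
    using assms by (intro mult_left_mono) (auto simp: power2_eq_square algebra_simps)
  also have "\<dots> = (1 + x) ^ 5" by (simp add: power_add[symmetric])
  also have "\<dots> \<le> 120 * exp (1 + x)"
    using power_over_fact_le_exp[of "1 + x" 5] assms by (simp add: fact_numeral field_simps)
  also have "\<dots> \<le> 120 * (3 * exp x)"
    using exp_le by (simp add: exp_add)
  finally have "(1 + x) ^ 3 * (1 + x\<^sup>2) \<le> 360 * exp x" by simp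
  moreover have "1 + x\<^sup>2 > 0" using zero_le_power2[of x] by linarith
  ultimately show ?thesis by (simp add: field_simps exp_minus)
qed

lemma one_minus_exp_lower:
  fixes x :: real
  assumes "x > 0"
  shows "x / (1 + x) \<le> 1 - exp (- x)"
proof -
  have "exp (- x) \<le> 1 / (1 + x)"
    using exp_ge_add_one_self[of x] assms by (simp add: exp_minus field_simps)
  then show ?thesis using assms by (simp add: field_simps)
qed

text \<open>In the variable x = t m the quantity is t^(-i) exp (-x) (x / (1 - exp (-x)))^i, and the
  last quotient is at most 1 + x. Raising the exponent i to 3 gives one bound for all i.\<close>

lemma cum_upper:
  assumes t: "t > 0" and m: "m > 0" and i: "i \<le> 3"
  shows "cum i (exp (- t)) m \<le> 360 / t ^ i / (1 + (t * real m)\<^sup>2)"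
proof -
  define x where "x = t * real m"
  have x: "x > 0" using t m by (simp add: x_def)
  have q: "exp (- t) ^ m = exp (- x)" by (simp add: x_def exp_of_nat_mult[symmetric] mult.commute)
  have "cum i (exp (- t)) m = real m ^ i * exp (- x) / (1 - exp (- x)) ^ i"
    by (simp only: cum_def q)
  also have "\<dots> \<le> real m ^ i * exp (- x) / (x / (1 + x)) ^ i"
    using x one_minus_exp_lower[OF x]
    by (intro divide_left_mono power_mono mult_pos_pos zero_less_power) (auto intro: less_le_trans[of 0 "x / (1 + x)"])
  also have "\<dots> = (1 / t ^ i) * (exp (- x) * (1 + x) ^ i)"
    using t m x by (simp add: power_divide x_def power_mult_distrib field_simps)
  also have "\<dots> \<le> (1 / t ^ i) * (exp (- x) * (1 + x) ^ 3)"
    using t x i by (intro mult_left_mono power_increasing) auto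
  also have "\<dots> \<le> (1 / t ^ i) * (360 / (1 + x\<^sup>2))"
    using t x by (intro mult_left_mono exp_cubic_bound) auto
  finally show ?thesis by (simp add: x_def)
qed

text \<open>The integral test in telescoped form: by the mean value theorem each term is at most
  \<open>y\<close> times an increment of arctan.\<close>

lemma sum_inverse_one_plus_square:
  assumes y: "y > 0"
  shows "(\<Sum>n=1..N. 1 / (1 + (real n / y)\<^sup>2)) \<le> y * arctan (real N / y)"
proof (induction N)
  case (Suc N)
  have "\<exists>z. real N / y < z \<and> z < real (Suc N) / y \<and>
     arctan (real (Suc N) / y) - arctan (real N / y) = (real (Suc N) / y - real N / y) * inverse (1 + z\<^sup>2)"
    using y by (intro MVT2 DERIV_arctan) (auto simp: divide_strict_right_mono)
  then obtain z where z: "real N / y < z" "z < real (Suc N) / y"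
    "arctan (real (Suc N) / y) - arctan (real N / y) = (real (Suc N) / y - real N / y) * inverse (1 + z\<^sup>2)" by blast
  have z0: "0 < z" using z(1) y by (meson divide_nonneg_pos le_less_trans of_nat_0_le_iff)
  have "1 / (1 + (real (Suc N) / y)\<^sup>2) \<le> inverse (1 + z\<^sup>2)"
    using z z0 by (auto simp: inverse_eq_divide intro!: divide_left_mono power_mono mult_pos_pos add_pos_nonneg)
  also have "\<dots> = y * (arctan (real (Suc N) / y) - arctan (real N / y))"
  proof -
    have "y * (real (Suc N) / y - real N / y) = 1" using y by (simp add: field_simps)
    then show ?thesis unfolding z(3) by (metis mult.assoc mult_1)
  qed
  finally show ?case using Suc by (simp add: algebra_simps)
qed simp

text \<open>Since u^2 \<le> 1 + u^(2k), the general exponent reduces to k = 1 at the cost of a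
  factor 2; another 2 bounds arctan.\<close>

lemma sum_inverse_one_plus_power:
  assumes y: "y > 0" and k: "k \<ge> 1" and S: "finite S" "0 \<notin> S"
  shows "(\<Sum>n\<in>S. 1 / (1 + ((real n / y) ^ k)\<^sup>2)) \<le> 4 * y"
proof -
  have le: "1 / (1 + (u ^ k)\<^sup>2) \<le> 2 * (1 / (1 + u\<^sup>2))" if u: "u \<ge> 0" for u :: real
  proof -
    have "u\<^sup>2 \<le> 1 + (u ^ k)\<^sup>2"
    proof (cases "u \<le> 1")
      case True
      then have "u\<^sup>2 \<le> 1" using u by (simp add: power_le_one)
      then show ?thesis using zero_le_power2[of "u ^ k"] by linarith
    next
      case False
      then have "u ^ 1 \<le> u ^ k" using k by (intro power_increasing) auto
      then have "u\<^sup>2 \<le> (u ^ k)\<^sup>2" using u by (intro power_mono) auto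
      then show ?thesis by simp
    qed
    then have "1 + u\<^sup>2 \<le> 2 * (1 + (u ^ k)\<^sup>2)"
      unfolding distrib_left using zero_le_power2[of "u ^ k"] by linarith
    moreover have "1 + u\<^sup>2 > 0" "1 + (u ^ k)\<^sup>2 > 0" by (simp_all add: add_pos_nonneg)
    ultimately show ?thesis by (simp add: field_simps)
  qed
  have "(\<Sum>n\<in>S. 1 / (1 + ((real n / y) ^ k)\<^sup>2)) \<le> (\<Sum>n\<in>S. 2 * (1 / (1 + (real n / y)\<^sup>2)))"
    using y by (intro sum_mono le) auto
  also have "\<dots> = 2 * (\<Sum>n\<in>S. 1 / (1 + (real n / y)\<^sup>2))" by (simp add: sum_distrib_left)
  also have "(\<Sum>n\<in>S. 1 / (1 + (real n / y)\<^sup>2)) \<le> (\<Sum>n=1..Max (insert 0 S). 1 / (1 + (real n / y)\<^sup>2))"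
  proof (rule sum_mono2)
    show "S \<subseteq> {1..Max (insert 0 S)}"
    proof
      fix n assume n: "n \<in> S"
      then have "n \<noteq> 0" using S by metis
      then show "n \<in> {1..Max (insert 0 S)}" using n S by auto
    qed
  qed (auto simp: add_pos_nonneg less_imp_le)
  also have "\<dots> \<le> y * arctan (real (Max (insert 0 S)) / y)"
    by (rule sum_inverse_one_plus_square[OF y])
  also have "\<dots> \<le> y * 2"
    using y arctan_ubound[of "real (Max (insert 0 S)) / y"] pi_less_4 by (intro mult_left_mono) auto
  finally show ?thesis by simp
qed

text \<open>The set is only required to consist of positive integers: for upper bounds the primes
  are treated like all integers. The constant is 360 times 4.\<close>

lemma sum_cum_upper:
  assumes y: "y > 0" and k: "k \<ge> 1" and S: "finite S" "0 \<notin> S" and i: "i \<le> 3"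
  shows "(\<Sum>n\<in>S. cum i (exp (- (1 / y ^ k))) (n ^ k)) \<le> 1440 * y ^ (k * i + 1)"
proof -
  have "(\<Sum>n\<in>S. cum i (exp (- (1 / y ^ k))) (n ^ k))
      \<le> (\<Sum>n\<in>S. 360 * y ^ (k * i) * (1 / (1 + ((real n / y) ^ k)\<^sup>2)))"
  proof (rule sum_mono)
    fix n assume "n \<in> S"
    then have "n > 0" using S by (metis gr0I)
    then have "cum i (exp (- (1 / y ^ k))) (n ^ k) \<le> 360 / (1 / y ^ k) ^ i / (1 + (1 / y ^ k * real (n ^ k))\<^sup>2)"
      using y by (intro cum_upper i) auto
    also have "\<dots> = 360 * y ^ (k * i) * (1 / (1 + ((real n / y) ^ k)\<^sup>2))"
      by (simp add: power_divide power_mult)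
    finally show "cum i (exp (- (1 / y ^ k))) (n ^ k) \<le> 360 * y ^ (k * i) * (1 / (1 + ((real n / y) ^ k)\<^sup>2))" .
  qed
  also have "\<dots> = 360 * y ^ (k * i) * (\<Sum>n\<in>S. 1 / (1 + ((real n / y) ^ k)\<^sup>2))"
    by (simp add: sum_distrib_left)
  also have "\<dots> \<le> 360 * y ^ (k * i) * (4 * y)"
    using y by (intro mult_left_mono sum_inverse_one_plus_power k S) auto
  finally show ?thesis by (simp add: mult.commute)
qed

lemma cum_nonneg: "0 < r \<Longrightarrow> r < 1 \<Longrightarrow> 0 \<le> cum i r m"
  by (auto simp: cum_def power_le_one intro!: divide_nonneg_nonneg mult_nonneg_nonneg)

lemma exp_minus_one_ge: "1 / 3 \<le> exp (- 1 :: real)"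
  using exp_le by (simp add: exp_minus inverse_eq_divide field_simps)

text \<open>For n \<le> y the variable x = (n/y)^k is at most 1, where 1 - exp (-x) \<le> x and exp
  (-x) \<ge> 1/3. So each prime up to \<open>y\<close> already contributes y^(2k) / 3.\<close>

lemma sum_cum_2_lower:
  assumes y: "y > 0" and k: "k \<ge> 1" and S: "finite S" "{p. prime p \<and> real p \<le> y} \<subseteq> S"
  shows "y ^ (2 * k) / 3 * real (card {p. prime p \<and> real p \<le> y}) \<le> (\<Sum>n\<in>S. cum 2 (exp (- (1 / y ^ k))) (n ^ k))"
proof -
  let ?P = "{p. prime p \<and> real p \<le> y}"
  have "y ^ (2 * k) / 3 * real (card ?P) = (\<Sum>n\<in>?P. y ^ (2 * k) / 3)" by simp
  also have "\<dots> \<le> (\<Sum>n\<in>?P. cum 2 (exp (- (1 / y ^ k))) (n ^ k))"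
  proof (rule sum_mono)
    fix n assume n: "n \<in> ?P"
    then have n0: "n > 0" by (auto simp: prime_gt_0_nat)
    define x where "x = (real n / y) ^ k"
    have x: "0 < x" "x \<le> 1" using n n0 y by (auto simp: x_def power_le_one)
    have q: "exp (- (1 / y ^ k)) ^ (n ^ k) = exp (- x)"
      by (simp add: x_def exp_of_nat_mult[symmetric] power_divide)
    have "1 - exp (- x) \<le> x" "0 < 1 - exp (- x)" using exp_ge_add_one_self[of "- x"] x by auto
    then have "(1 - exp (- x))\<^sup>2 \<le> x\<^sup>2" "0 < (1 - exp (- x))\<^sup>2" by (auto intro: power_mono)
    moreover have "1 / 3 \<le> exp (- x)" using exp_minus_one_ge x by (meson exp_le_cancel_iff neg_le_iff_le order_trans)
    ultimately have "(1 / 3) / x\<^sup>2 \<le> exp (- x) / (1 - exp (- x))\<^sup>2"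
      using x by (intro frac_le) auto
    then have "real (n ^ k) ^ 2 * ((1 / 3) / x\<^sup>2) \<le> real (n ^ k) ^ 2 * (exp (- x) / (1 - exp (- x))\<^sup>2)"
      by (intro mult_left_mono) auto
    also have "\<dots> = cum 2 (exp (- (1 / y ^ k))) (n ^ k)" unfolding cum_def q by simp
    also have "real (n ^ k) ^ 2 * ((1 / 3) / x\<^sup>2) = y ^ (2 * k) / 3"
      using n0 y by (simp add: x_def power_divide power_mult[symmetric] mult.commute field_simps)
    finally show "y ^ (2 * k) / 3 \<le> cum 2 (exp (- (1 / y ^ k))) (n ^ k)" .
  qed
  also have "\<dots> \<le> (\<Sum>n\<in>S. cum 2 (exp (- (1 / y ^ k))) (n ^ k))"
    using S y by (intro sum_mono2) (auto intro!: cum_nonneg)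
  finally show ?thesis .
qed

section \<open>Chord lengths and the modulus of \<open>geo_char\<close>\<close>

lemma sin_ge_half:
  assumes "0 \<le> u" "u \<le> pi / 2"
  shows "u / 2 \<le> sin u"
proof (cases "u \<le> pi / 3")
  case True
  show ?thesis
  proof (cases "u = 0")
    case False
    then have "\<exists>z>0. z < u \<and> sin u - sin 0 = (u - 0) * cos z"
      using assms by (intro MVT2) auto
    then obtain z where z: "0 < z" "z < u" "sin u = u * cos z" by auto
    have "cos (pi / 3) \<le> cos z" using z True pi_gt_zero by (intro cos_monotone_0_pi_le) linarith+
    then show ?thesis using z(3) assms mult_left_mono[of "1 / 2" "cos z" u] by (simp add: cos_60)
  qed simp
next
  case False
  \<comment> \<open>Beyond pi / 3 the sine is at least 4/5, while u / 2 \<le> pi / 4 < 4/5.\<close>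
  have "sin (pi / 3) \<le> sin u" using False assms pi_gt_zero by (intro sin_monotone_2pi_le) linarith+
  moreover have "sin (pi / 3) \<ge> 4 / 5"
    unfolding sin_60 using real_le_rsqrt[of "8 / 5" 3] by (simp add: power2_eq_square)
  moreover have "pi < 3.2" using pi_approx by simp
  ultimately show ?thesis using assms by simp
qed

lemma norm_one_minus_cis: "norm (1 - cis \<phi>) ^ 2 = 2 - 2 * cos \<phi>"
proof -
  have "norm (1 - cis \<phi>) ^ 2 = (1 - cos \<phi>)\<^sup>2 + (sin \<phi>)\<^sup>2"
    by (simp add: cmod_power2)
  also have "\<dots> = 2 - 2 * cos \<phi>"
    using sin_cos_squared_add[of \<phi>] by (simp add: power2_diff)
  finally show ?thesis .
qed

lemma norm_one_minus_cis_lower: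
  assumes "\<bar>\<phi>\<bar> \<le> pi"
  shows "\<bar>\<phi>\<bar> / 2 \<le> norm (1 - cis \<phi>)"
proof -
  have eq: "2 - 2 * cos \<phi> = (2 * sin (\<bar>\<phi>\<bar> / 2))\<^sup>2"
    using cos_double_sin[of "\<phi> / 2"] by (cases "\<phi> \<ge> 0") (auto simp: power_mult_distrib)
  have "norm (1 - cis \<phi>) = sqrt ((norm (1 - cis \<phi>))\<^sup>2)" by (simp only: real_sqrt_abs abs_norm_cancel)
  also have "\<dots> = \<bar>2 * sin (\<bar>\<phi>\<bar> / 2)\<bar>" unfolding norm_one_minus_cis eq by (rule real_sqrt_abs)
  finally have "norm (1 - cis \<phi>) = \<bar>2 * sin (\<bar>\<phi>\<bar> / 2)\<bar>" .
  moreover have "\<bar>\<phi>\<bar> / 2 / 2 \<le> sin (\<bar>\<phi>\<bar> / 2)" using assms by (intro sin_ge_half) auto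
  ultimately show ?thesis by linarith
qed

text \<open>This rests on |1 - q cis \<phi>|^2 = (1 - q)^2 + q |1 - cis \<phi>|^2. Once r^m is
  bounded below, the saving of a factor depends only on how the chord |1 - cis (m \<theta>)|
  compares with 1 - r^m.\<close>

lemma norm_geo_char:
  assumes "0 < r" "r < 1" "m > 0"
  shows "(norm (geo_char r m \<theta>))\<^sup>2 = 1 / (1 + r ^ m * (norm (1 - cis (real m * \<theta>)))\<^sup>2 / (1 - r ^ m)\<^sup>2)"
proof -
  define q where "q = r ^ m"
  define \<phi> where "\<phi> = real m * \<theta>"
  have q: "0 < q" "q < 1" using assms by (auto simp: q_def power_less_one_iff)
  have "norm (1 - of_real q * cis \<phi>) ^ 2 = (1 - q * cos \<phi>)\<^sup>2 + (q * sin \<phi>)\<^sup>2"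
    by (simp add: cmod_power2)
  also have "\<dots> = (1 - q)\<^sup>2 + q * (2 - 2 * cos \<phi>)"
    unfolding power_mult_distrib sin_squared_eq by (simp add: power2_eq_square algebra_simps)
  finally have d: "norm (1 - of_real q * cis \<phi>) ^ 2 = (1 - q)\<^sup>2 + q * (norm (1 - cis \<phi>))\<^sup>2"
    by (simp only: norm_one_minus_cis)
  have "norm (1 - complex_of_real q) = 1 - q"
    using q by (metis abs_of_pos diff_gt_0_iff_gt norm_of_real of_real_1 of_real_diff)
  then have "(norm (geo_char r m \<theta>))\<^sup>2 = (1 - q)\<^sup>2 / ((1 - q)\<^sup>2 + q * (norm (1 - cis \<phi>))\<^sup>2)"
    unfolding geo_char_def norm_divide power_divide q_def[symmetric] \<phi>_def[symmetric] d by simp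
  also have "\<dots> = 1 / (1 + q * (norm (1 - cis \<phi>))\<^sup>2 / (1 - q)\<^sup>2)"
  proof -
    have "(1 - q)\<^sup>2 > 0" using q by simp
    moreover have "(1 - q)\<^sup>2 + q * (norm (1 - cis \<phi>))\<^sup>2 > 0" using q by (intro add_pos_nonneg) auto
    ultimately show ?thesis by (simp add: field_simps)
  qed
  finally show ?thesis by (simp add: q_def \<phi>_def)
qed

lemma norm_geo_char_sq_le:
  assumes "0 < r" "r < 1" "m > 0" "0 \<le> Y" "Y \<le> r ^ m * (norm (1 - cis (real m * \<theta>)))\<^sup>2 / (1 - r ^ m)\<^sup>2"
  shows "(norm (geo_char r m \<theta>))\<^sup>2 \<le> 1 / (1 + Y)"
  unfolding norm_geo_char[OF assms(1-3)] using assms(4,5) by (intro divide_left_mono) auto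

lemma norm_geo_char_le_1:
  assumes "0 < r" "r < 1" "m > 0"
  shows "norm (geo_char r m \<theta>) \<le> 1"
proof -
  have "(norm (geo_char r m \<theta>))\<^sup>2 \<le> 1 / (1 + 0)"
    using assms by (intro norm_geo_char_sq_le) auto
  then show ?thesis by (simp add: power_le_one_iff)
qed

section \<open>The characteristic function away from zero\<close>

text \<open>With a x = b y + 1, multiplying 1 - z by the unit z^(b y) gives (1 - z^(a x)) - (1 -
  z^(b y)), and |1 - w^n| \<le> n |1 - w| on the unit circle.\<close>

lemma norm_one_minus_power_coprime:
  assumes "coprime a b" "a > (0::nat)"
  shows "\<exists>C>0. \<forall>z::complex. norm z = 1 \<longrightarrow> norm (1 - z) \<le> C * max (norm (1 - z ^ a)) (norm (1 - z ^ b))"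
proof -
  obtain x y where xy: "a * x = b * y + 1"
    using bezout_nat[of a b] assms by auto
  show ?thesis
  proof (intro exI[of _ "real (x + y + 1)"] conjI allI impI)
    fix z :: complex assume z: "norm z = 1"
    define D where "D = max (norm (1 - z ^ a)) (norm (1 - z ^ b))"
    have pw: "norm (1 - (z ^ c) ^ n) \<le> real n * norm (1 - z ^ c)" for c n
      using norm_power_diff[of 1 "z ^ c" n] z by (simp add: norm_power)
    have "norm (1 - z) = norm (z ^ (b * y) * (1 - z))" using z by (simp add: norm_mult norm_power)
    also have "z ^ (b * y) * (1 - z) = (1 - (z ^ a) ^ x) - (1 - (z ^ b) ^ y)"
      unfolding power_mult[symmetric] xy by (simp add: algebra_simps)
    also have "norm \<dots> \<le> norm (1 - (z ^ a) ^ x) + norm (1 - (z ^ b) ^ y)"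
      by (rule norm_triangle_ineq4)
    also have "\<dots> \<le> real x * norm (1 - z ^ a) + real y * norm (1 - z ^ b)"
      by (intro add_mono pw)
    also have "\<dots> \<le> real x * D + real y * D"
      by (intro add_mono mult_left_mono) (auto simp: D_def)
    also have "\<dots> \<le> real (x + y + 1) * D"
      by (simp add: algebra_simps D_def max_def)
    finally show "norm (1 - z) \<le> real (x + y + 1) * D" .
  qed simp
qed

text \<open>Two bad primes p and q would contradict the coprime case for p^k and q^k, provided the
  constant dominates the one belonging to each pair.\<close>

lemma finite_primes_one_bad:
  fixes P :: "nat set"
  assumes "finite P" "\<And>p. p \<in> P \<Longrightarrow> prime p" "k \<ge> 1"
  obtains C where "C > 0"
    "\<And>z::complex. norm z = 1 \<Longrightarrow> card {p \<in> P. C * norm (1 - z ^ (p ^ k)) < norm (1 - z)} \<le> 1"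
proof -
  have "\<exists>C>0. \<forall>z::complex. norm z = 1 \<longrightarrow>
      norm (1 - z) \<le> C * max (norm (1 - z ^ (p ^ k))) (norm (1 - z ^ (q ^ k)))"
    if "p \<in> P" "q \<in> P" "p \<noteq> q" for p q
    using that assms(2) primes_coprime[of p q]
    by (intro norm_one_minus_power_coprime) (auto simp: prime_gt_0_nat)
  then obtain C where C: "\<And>p q. p \<in> P \<Longrightarrow> q \<in> P \<Longrightarrow> p \<noteq> q \<Longrightarrow> C p q > 0"
    "\<And>p q z. p \<in> P \<Longrightarrow> q \<in> P \<Longrightarrow> p \<noteq> q \<Longrightarrow> norm z = 1 \<Longrightarrow>
      norm (1 - z) \<le> C p q * max (norm (1 - z ^ (p ^ k))) (norm (1 - z ^ (q ^ k :: nat) :: complex))"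
    by metis
  \<comment> \<open>The sum dominates every pair constant, and the summand 1 keeps \<open>B\<close>
    positive when there are no pairs.\<close>
  define B where "B = 1 + (\<Sum>(p, q)\<in>P \<times> P. \<bar>C p q\<bar>)"
  have CB: "C p q \<le> B" if "p \<in> P" "q \<in> P" for p q
  proof -
    have "\<bar>C p q\<bar> \<le> (\<Sum>(p, q)\<in>P \<times> P. \<bar>C p q\<bar>)"
      using member_le_sum[of "(p, q)" "P \<times> P" "\<lambda>(p, q). \<bar>C p q\<bar>"] that assms(1) by auto
    then show ?thesis unfolding B_def by linarith
  qed
  have "B > 0" unfolding B_def by (intro add_pos_nonneg sum_nonneg) auto
  moreover have "card {p \<in> P. B * norm (1 - z ^ (p ^ k)) < norm (1 - z)} \<le> 1" if z: "norm z = 1" for z :: complex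
  proof (rule ccontr)
    assume "\<not> ?thesis"
    then obtain p q where pq: "p \<noteq> q" "p \<in> P" "q \<in> P"
      "B * norm (1 - z ^ (p ^ k)) < norm (1 - z)" "B * norm (1 - z ^ (q ^ k)) < norm (1 - z)"
      using card_le_Suc0_iff_eq[of "{p \<in> P. B * norm (1 - z ^ (p ^ k)) < norm (1 - z)}"] assms(1) by auto
    have "norm (1 - z) \<le> C p q * max (norm (1 - z ^ (p ^ k))) (norm (1 - z ^ (q ^ k)))"
      using pq z by (intro C)
    also have "\<dots> \<le> B * max (norm (1 - z ^ (p ^ k))) (norm (1 - z ^ (q ^ k)))"
      using pq by (intro mult_right_mono CB) (auto simp: max_def)
    also have "\<dots> < norm (1 - z)" using pq by (simp add: max_def)
    finally show False by simp
  qed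
  ultimately show ?thesis by (rule that)
qed

text \<open>Among 19 fixed primes at least 18 are good in the sense of the previous lemma, and each of their
  factors is \<open>O(y\<^sup>-\<^sup>k / \<bar>\<theta>\<bar>) = O(y powr (- k / 6))\<close>.\<close>

lemma char_far_outer:
  assumes k: "k \<ge> 1"
  obtains C y0 where "C > 0" "y0 \<ge> 1"
    "\<And>y S \<theta>. y \<ge> y0 \<Longrightarrow> finite S \<Longrightarrow> 0 \<notin> S \<Longrightarrow> {p. prime p \<and> real p \<le> y} \<subseteq> S \<Longrightarrow> \<bar>\<theta>\<bar> \<le> pi \<Longrightarrow>
       y powr (- (5 * k / 6)) \<le> \<bar>\<theta>\<bar> \<Longrightarrow>
       (\<Prod>p\<in>S. norm (geo_char (exp (- (1 / y ^ k))) (p ^ k) \<theta>)) \<le> C / y ^ (3 * k)"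
proof -
  \<comment> \<open>18 factors of order y powr (-k/6) give y^(-3k). This is small against the peak 1
    / sqrt V, which is at least of order y^(-k - 1/2).\<close>
  obtain P where P: "finite P" "card P = 19" "P \<subseteq> {p::nat. prime p}"
    using infinite_arbitrarily_large[OF primes_infinite, of 19] by auto
  obtain C0 where C0: "C0 > 0"
    "\<And>z::complex. norm z = 1 \<Longrightarrow> card {p \<in> P. C0 * norm (1 - z ^ (p ^ k)) < norm (1 - z)} \<le> 1"
    using finite_primes_one_bad[OF P(1) _ k] P(3) by blast
  define L where "L = real (Max P)"
  have L: "real p \<le> L" if "p \<in> P" for p using P(1) that by (simp add: L_def)
  have L0: "L \<ge> 0" by (simp add: L_def)
  define A where "A = 4 * C0 * L ^ k + 1"
  have A: "A > 0" using C0 L0 by (simp add: A_def add_nonneg_pos)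
  \<comment> \<open>\<open>y \<ge> L\<close> puts all of \<open>P\<close> into \<open>S\<close>; the
    last bound makes \<open>D \<le> 1\<close>, so that surplus good primes do no harm.\<close>
  define y0 where "y0 = max (max 1 L) (A powr (6 / k))"
  show ?thesis
  proof (rule that[of "A ^ 18" y0])
    fix y \<theta> :: real and S :: "nat set"
    assume y: "y \<ge> y0" and S: "finite S" "0 \<notin> S" "{p. prime p \<and> real p \<le> y} \<subseteq> S"
      and \<theta>: "\<bar>\<theta>\<bar> \<le> pi" "y powr (- (5 * k / 6)) \<le> \<bar>\<theta>\<bar>"
    have y1: "y \<ge> 1" "y \<ge> L" "y \<ge> A powr (6 / k)" using y by (auto simp: y0_def)
    have \<theta>0: "\<bar>\<theta>\<bar> > 0" using \<theta>(2) y1 by (smt (verit) powr_gt_zero)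
    define t where "t = 1 / y ^ k"
    have t: "t > 0" "exp (- t) < 1" using y1 by (auto simp: t_def)
    let ?f = "\<lambda>p. geo_char (exp (- t)) (p ^ k) \<theta>"
    have f1: "norm (?f p) \<le> 1" if "p \<in> S" for p
      using that S(2) t by (intro norm_geo_char_le_1) (auto intro!: gr0I)
    have PS: "P \<subseteq> S"
    proof
      fix p assume "p \<in> P"
      then show "p \<in> S" using P(3) L[of p] y1(2) S(3) by auto
    qed
    define G where "G = {p \<in> P. norm (1 - cis \<theta>) \<le> C0 * norm (1 - cis \<theta> ^ (p ^ k))}"
    define D where "D = A * y powr (- (k / 6))"
    have D: "0 \<le> D" "D \<le> 1"
    proof -
      have "A = (A powr (6 / k)) powr (k / 6)" using A k by (simp add: powr_powr)
      also have "\<dots> \<le> y powr (k / 6)" using y1 by (intro powr_mono2) auto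
      finally show "D \<le> 1" using y1 by (simp add: D_def powr_minus field_simps)
    qed (use A in \<open>simp add: D_def\<close>)
    have "card P = card G + card {p \<in> P. C0 * norm (1 - cis \<theta> ^ (p ^ k)) < norm (1 - cis \<theta>)}"
      unfolding G_def using P(1) by (subst card_Un_disjoint[symmetric]) (auto intro: arg_cong[of _ _ card])
    moreover have "card {p \<in> P. C0 * norm (1 - cis \<theta> ^ (p ^ k)) < norm (1 - cis \<theta>)} \<le> 1"
      by (intro C0) simp
    ultimately have G: "card G \<ge> 18" using P(2) by linarith
    have GS: "G \<subseteq> S" using PS by (auto simp: G_def)
    have fG: "norm (?f p) \<le> D" if p: "p \<in> G" for p
    proof -
      have pP: "p \<in> P" using p by (simp add: G_def)
      then have p0: "p > 0" using P(3) by (auto simp: prime_gt_0_nat)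
      define q where "q = exp (- t) ^ (p ^ k)"
      have q: "q = exp (- (t * real (p ^ k)))" by (simp add: q_def exp_of_nat_mult[symmetric] mult.commute)
      have tm: "t * real (p ^ k) \<le> 1"
        using L[OF pP] y1 by (simp add: t_def field_simps power_mono)
      have "1 / 3 \<le> q" unfolding q using tm exp_minus_one_ge by (meson exp_le_cancel_iff neg_le_iff_le order_trans)
      have "1 - q \<le> t * real (p ^ k)" unfolding q using exp_ge_add_one_self[of "- (t * real (p ^ k))"] by linarith
      also have "\<dots> \<le> t * L ^ k" using L[OF pP] t by (simp add: power_mono)
      finally have q1: "1 - q \<le> t * L ^ k" .
      have q2: "0 < 1 - q" unfolding q using t p0 by simp
      have LA: "0 < L ^ k" using q1 q2 t by (smt (verit) mult_nonneg_nonpos)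
      have "\<bar>\<theta>\<bar> / 2 \<le> norm (1 - cis \<theta>)" by (rule norm_one_minus_cis_lower[OF \<theta>(1)])
      also have "\<dots> \<le> C0 * norm (1 - cis (real (p ^ k) * \<theta>))"
        using p by (simp only: G_def Complex.DeMoivre) simp
      finally have w: "\<bar>\<theta>\<bar> / (2 * C0) \<le> norm (1 - cis (real (p ^ k) * \<theta>))"
        using C0 by (simp add: field_simps)
      \<comment> \<open>Rounding \<open>1 / 3 \<le> q\<close> down to 1/4 makes the lower bound a
        perfect square, so a square root can be taken at the end.\<close>
      define Y where "Y = (\<bar>\<theta>\<bar> / (4 * C0 * t * L ^ k))\<^sup>2"
      have "Y = (1 / 4) * (\<bar>\<theta>\<bar> / (2 * C0))\<^sup>2 / (t * L ^ k)\<^sup>2"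
        by (simp add: Y_def power_divide power_mult_distrib)
      also have "\<dots> \<le> q * (norm (1 - cis (real (p ^ k) * \<theta>)))\<^sup>2 / (1 - q)\<^sup>2"
        using q1 q2 w \<open>1 / 3 \<le> q\<close> C0 by (intro frac_le mult_mono power_mono) auto
      finally have "(norm (?f p))\<^sup>2 \<le> 1 / (1 + Y)"
        using t p0 by (intro norm_geo_char_sq_le) (auto simp: q_def Y_def)
      also have "\<dots> \<le> 1 / Y"
      proof -
        have "4 * C0 * t * L ^ k > 0" using C0(1) t LA by simp
        then have "Y > 0" unfolding Y_def using \<theta>0 by (intro zero_less_power divide_pos_pos)
        then show ?thesis by (simp add: frac_le)
      qed
      also have "\<dots> = (4 * C0 * t * L ^ k / \<bar>\<theta>\<bar>)\<^sup>2" by (simp add: Y_def power_divide)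
      finally have "norm (?f p) \<le> 4 * C0 * t * L ^ k / \<bar>\<theta>\<bar>"
        by (rule power2_le_imp_le) (use C0 t LA in auto)
      also have "\<dots> \<le> 4 * C0 * t * L ^ k / y powr (- (5 * k / 6))"
        using C0 t LA \<theta> y1 by (intro divide_left_mono) (auto intro!: mult_pos_pos)
      also have "\<dots> = (4 * C0 * L ^ k) * y powr (- (k / 6))"
      proof -
        have "t = y powr (- real k)" using y1 by (simp add: t_def powr_minus powr_realpow inverse_eq_divide)
        moreover have "y powr (- real k) / y powr (- (5 * k / 6)) = y powr (- (k / 6))"
          using y1 by (simp add: powr_diff[symmetric])
        ultimately have "t / y powr (- (5 * k / 6)) = y powr (- (k / 6))" by (simp only:)
        then have "(4 * C0 * L ^ k) * (t / y powr (- (5 * k / 6))) = (4 * C0 * L ^ k) * y powr (- (k / 6))"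
          by (simp only:)
        then show ?thesis by (simp only: times_divide_eq_right mult_ac)
      qed
      also have "\<dots> \<le> D" unfolding D_def A_def by (intro mult_right_mono) auto
      finally show ?thesis .
    qed
    have "(\<Prod>p\<in>S. norm (?f p)) = (\<Prod>p\<in>S - G. norm (?f p)) * (\<Prod>p\<in>G. norm (?f p))"
      by (rule prod.subset_diff[OF GS S(1)])
    also have "\<dots> \<le> 1 * (\<Prod>p\<in>G. D)"
      using f1 fG by (intro mult_mono prod_le_1 prod_mono prod_nonneg) auto
    also have "\<dots> = D ^ card G" by simp
    also have "\<dots> \<le> D ^ 18" using D G by (intro power_decreasing)
    also have "\<dots> = A ^ 18 / y ^ (3 * k)"
    proof -
      have "(y powr (- (k / 6))) ^ 18 = y powr (- real (3 * k))"
        using y1 by (simp add: powr_realpow[symmetric] powr_powr)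
      also have "\<dots> = 1 / y ^ (3 * k)" using y1 by (simp only: powr_minus powr_realpow inverse_eq_divide)
      finally show ?thesis by (simp add: D_def power_mult_distrib)
    qed
    finally show "(\<Prod>p\<in>S. norm (geo_char (exp (- (1 / y ^ k))) (p ^ k) \<theta>)) \<le> A ^ 18 / y ^ (3 * k)"
      by (simp add: t_def)
  qed (use A in \<open>auto simp: y0_def\<close>)
qed

text \<open>The exponential beats any power: its Taylor term of order 9 j is a multiple of y^j. The
  exponent 1/9 is the one produced in \<open>char_far_inner\<close>.\<close>

lemma exp_minus_powr_bound:
  fixes c y :: real
  assumes "c > 0" "y > 0"
  shows "exp (- (c * y powr (1 / 9))) \<le> fact (9 * j) / c ^ (9 * j) / y ^ j"
proof -
  have "(c * y powr (1 / 9)) ^ (9 * j) / fact (9 * j) \<le> exp (c * y powr (1 / 9))"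
    using assms by (intro power_over_fact_le_exp) auto
  moreover have "(y powr (1 / 9)) ^ (9 * j) = y ^ j"
  proof -
    have "(y powr (1 / 9)) ^ (9 * j) = y powr real j"
      using assms by (simp add: powr_realpow[symmetric] powr_powr)
    then show ?thesis using assms by (simp add: powr_realpow)
  qed
  ultimately have "c ^ (9 * j) * y ^ j / fact (9 * j) \<le> exp (c * y powr (1 / 9))"
    by (simp only: power_mult_distrib)
  then have "inverse (exp (c * y powr (1 / 9))) \<le> inverse (c ^ (9 * j) * y ^ j / fact (9 * j))"
    using assms by (intro le_imp_inverse_le) auto
  then show ?thesis by (simp add: exp_minus inverse_eq_divide)
qed

text \<open>In this range |\<theta>| is at least of order y powr (-k - 1/3), and p^k |\<theta>|
  \<le> 1 for p \<le> x = y powr (5/6), so the angles do not wrap around. Each such prime then saves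
  a factor 1 + Y in the squared modulus with Y of order y powr (-2/3), and there are enough of them
  for the product to decay exponentially in a power of y.\<close>

lemma char_far_inner:
  assumes k: "k \<ge> 1"
  obtains C y0 where "C > 0" "y0 \<ge> 1"
    "\<And>y S \<theta>. y \<ge> y0 \<Longrightarrow> finite S \<Longrightarrow> 0 \<notin> S \<Longrightarrow> {p. prime p \<and> real p \<le> y} \<subseteq> S \<Longrightarrow> \<bar>\<theta>\<bar> \<le> pi \<Longrightarrow>
       1 \<le> 1440 * y ^ (3 * k + 1) * \<bar>\<theta>\<bar> ^ 3 \<Longrightarrow> \<bar>\<theta>\<bar> \<le> y powr (- (5 * k / 6)) \<Longrightarrow>
       (\<Prod>p\<in>S. norm (geo_char (exp (- (1 / y ^ k))) (p ^ k) \<theta>)) \<le> C / y ^ (3 * k)"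
proof -
  \<comment> \<open>With \<delta> = 1/15 the exponents combine to (5/6)(14/15) - 2/3 = 1/9 >
    0.\<close>
  obtain c where c: "c > 0" "\<And>x. x \<ge> 2 \<Longrightarrow> c * x powr (1 - 1 / 15) \<le> real (card {p. prime p \<and> real p \<le> x})"
    using prime_count_lower[of "1 / 15"] by auto
  define a where "a = c / 1728 / 4"
  have a: "a > 0" using c by (simp add: a_def)
  define C where "C = fact (9 * (3 * k)) / a ^ (9 * (3 * k))"
  show ?thesis
  proof (rule that[of C 4])
    fix y \<theta> :: real and S :: "nat set"
    assume y: "y \<ge> 4" and S: "finite S" "0 \<notin> S" "{p. prime p \<and> real p \<le> y} \<subseteq> S"
      and \<theta>: "\<bar>\<theta>\<bar> \<le> pi" "1 \<le> 1440 * y ^ (3 * k + 1) * \<bar>\<theta>\<bar> ^ 3" "\<bar>\<theta>\<bar> \<le> y powr (- (5 * k / 6))"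
    define t where "t = 1 / y ^ k"
    have t: "t > 0" "exp (- t) < 1" using y by (auto simp: t_def)
    let ?f = "\<lambda>p. geo_char (exp (- t)) (p ^ k) \<theta>"
    have f1: "norm (?f p) \<le> 1" if "p \<in> S" for p
      using that S(2) t by (intro norm_geo_char_le_1) (auto intro!: gr0I)
    define x where "x = y powr (5 / 6)"
    have x: "2 \<le> x" "x \<le> y"
    proof -
      have "2 = 4 powr (1 / 2 :: real)" by (simp add: powr_half_sqrt)
      also have "\<dots> \<le> 4 powr (5 / 6 :: real)" by (intro powr_mono) auto
      also have "\<dots> \<le> x" unfolding x_def using y by (intro powr_mono2) auto
      finally show "2 \<le> x" .
      have "x \<le> y powr 1" unfolding x_def using y by (intro powr_mono) auto
      then show "x \<le> y" using y by simp
    qed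
    define G where "G = {p. prime p \<and> real p \<le> x}"
    have GS: "G \<subseteq> S" using S(3) x by (auto simp: G_def)
    \<comment> \<open>1728 = 12^3 exceeds 1440, so \<bar>\<theta>\<bar> is at least v = y powr (-k -
      1/3) / 12, and Y = v^2 / (12 t^2). The last 12 is 3 from \<open>1 / 3 \<le> q\<close> times 4
      from squaring the chord bound.\<close>
    define Y where "Y = y powr (- (2 / 3)) / 1728"
    have Y: "0 < Y" "Y \<le> 1"
    proof -
      have "y powr (- (2 / 3)) \<le> y powr 0" using y by (intro powr_mono) auto
      then show "Y \<le> 1" using y by (simp add: Y_def)
    qed (use y in \<open>simp add: Y_def\<close>)
    have Y\<theta>: "Y \<le> \<theta>\<^sup>2 / (12 * t\<^sup>2)"
    proof -
      define v where "v = y powr (- real k - 1 / 3) / 12"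
      have v0: "v \<ge> 0" by (simp add: v_def)
      have "(y powr (- real k - 1 / 3)) ^ 3 = y powr ((- real k - 1 / 3) * 3)"
        using y by (simp add: powr_realpow[symmetric] powr_powr)
      also have "(- real k - 1 / 3) * 3 = - real (3 * k + 1)" by simp
      finally have "v ^ 3 = y powr (- real (3 * k + 1)) / 1728"
        by (simp add: v_def power_divide)
      also have "\<dots> = 1 / (1728 * y ^ (3 * k + 1))"
        using y by (simp only: powr_minus powr_realpow) (simp add: field_simps)
      also have "\<dots> \<le> 1 / (1440 * y ^ (3 * k + 1))" using y by (intro divide_left_mono) auto
      also have "\<dots> \<le> \<bar>\<theta>\<bar> ^ 3" using \<theta>(2) y by (simp add: field_simps)
      finally have "v \<le> \<bar>\<theta>\<bar>" by (rule power_mono_iff[THEN iffD1, rotated -1]) (use v0 in auto)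
      then have "v\<^sup>2 \<le> \<theta>\<^sup>2" using v0 by (metis abs_ge_zero power2_abs power_mono)
      moreover have "v\<^sup>2 = 12 * t\<^sup>2 * Y"
      proof -
        have "v\<^sup>2 = y powr (- 2 * real k - 2 / 3) / 144"
          using y by (simp add: v_def power_divide powr_realpow[symmetric] powr_powr algebra_simps)
        also have "y powr (- 2 * real k - 2 / 3) = y powr (- 2 * real k) * y powr (- (2 / 3))"
          by (simp add: powr_add[symmetric])
        also have "y powr (- 2 * real k) = t\<^sup>2"
        proof -
          have "y powr (- 2 * real k) = y powr (- real (2 * k))" by simp
          also have "\<dots> = 1 / y ^ (2 * k)" using y by (simp only: powr_minus powr_realpow) (simp add: field_simps)
          also have "\<dots> = t\<^sup>2" by (simp add: t_def power_divide power_mult[symmetric] mult.commute)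
          finally show ?thesis .
        qed
        finally show ?thesis by (simp add: Y_def)
      qed
      ultimately show ?thesis using t by (simp add: field_simps)
    qed
    have fG: "(norm (?f p))\<^sup>2 \<le> exp (- (Y / 2))" if p: "p \<in> G" for p
    proof -
      have p0: "p > 0" using p by (auto simp: G_def prime_gt_0_nat)
      define q where "q = exp (- t) ^ (p ^ k)"
      have q: "q = exp (- (t * real (p ^ k)))" by (simp add: q_def exp_of_nat_mult[symmetric] mult.commute)
      have tm: "t * real (p ^ k) \<le> 1"
        using p x y by (simp add: G_def t_def field_simps power_mono)
      have q3: "1 / 3 \<le> q" unfolding q using tm exp_minus_one_ge by (meson exp_le_cancel_iff neg_le_iff_le order_trans)
      have q1: "1 - q \<le> t * real (p ^ k)" unfolding q using exp_ge_add_one_self[of "- (t * real (p ^ k))"] by linarith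
      have q2: "0 < 1 - q" unfolding q using t p0 by simp
      have "real (p ^ k) \<le> x ^ k" using p by (simp add: G_def power_mono)
      also have "\<dots> = y powr (5 * k / 6)" using y by (simp add: x_def powr_realpow[symmetric] powr_powr)
      finally have "real (p ^ k) * \<bar>\<theta>\<bar> \<le> y powr (5 * k / 6) * y powr (- (5 * k / 6))"
        using \<theta>(3) by (intro mult_mono) auto
      also have "\<dots> = 1" using y by (simp add: powr_add[symmetric])
      finally have "\<bar>real (p ^ k) * \<theta>\<bar> \<le> pi" using pi_ge_two by (simp add: abs_mult)
      then have w: "\<bar>real (p ^ k) * \<theta>\<bar> / 2 \<le> norm (1 - cis (real (p ^ k) * \<theta>))"
        by (rule norm_one_minus_cis_lower)
      have "\<theta>\<^sup>2 / (12 * t\<^sup>2) = (1 / 3) * (\<bar>real (p ^ k) * \<theta>\<bar> / 2)\<^sup>2 / (t * real (p ^ k))\<^sup>2"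
        using p0 t by (simp add: power_divide power_mult_distrib)
      also have "\<dots> \<le> q * (norm (1 - cis (real (p ^ k) * \<theta>)))\<^sup>2 / (1 - q)\<^sup>2"
        using q1 q2 w q3 by (intro frac_le mult_mono power_mono) auto
      finally have "(norm (?f p))\<^sup>2 \<le> 1 / (1 + Y)"
        using t p0 Y Y\<theta> by (intro norm_geo_char_sq_le) (auto simp: q_def)
      \<comment> \<open>Uses exp u \<le> 1 + 2 u for 0 \<le> u \<le> 1/2, which is why
        \<open>Y \<le> 1\<close> was established.\<close>
      also have "\<dots> \<le> 1 / exp (Y / 2)"
        using real_exp_bound_lemma[of "Y / 2"] Y by (intro divide_left_mono) auto
      finally show ?thesis by (simp add: exp_minus inverse_eq_divide)
    qed
    have "(\<Prod>p\<in>S. norm (?f p)) = (\<Prod>p\<in>S - G. norm (?f p)) * (\<Prod>p\<in>G. norm (?f p))"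
      by (rule prod.subset_diff[OF GS S(1)])
    also have "\<dots> \<le> 1 * (\<Prod>p\<in>G. norm (?f p))"
      using f1 by (intro mult_mono prod_le_1 prod_nonneg) auto
    finally have le: "(\<Prod>p\<in>S. norm (?f p)) \<le> (\<Prod>p\<in>G. norm (?f p))" by simp
    have "(\<Prod>p\<in>G. norm (?f p))\<^sup>2 = (\<Prod>p\<in>G. (norm (?f p))\<^sup>2)" by (simp add: prod_power_distrib)
    also have "\<dots> \<le> (\<Prod>p\<in>G. exp (- (Y / 2)))" using fG by (intro prod_mono) auto
    also have "\<dots> = exp (- (real (card G) * (Y / 2)))" by (simp add: exp_of_nat_mult[symmetric])
    also have "\<dots> = (exp (- (real (card G) * (Y / 4))))\<^sup>2" by (simp add: exp_double[symmetric])
    finally have "(\<Prod>p\<in>G. norm (?f p)) \<le> exp (- (real (card G) * (Y / 4)))"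
      by (rule power2_le_imp_le) simp
    also have "\<dots> \<le> exp (- (a * y powr (1 / 9)))"
    proof -
      have "a * y powr (1 / 9) = c * x powr (1 - 1 / 15) * (Y / 4)"
      proof -
        have "x powr (1 - 1 / 15) * y powr (- (2 / 3)) = y powr (1 / 9)"
          using y by (simp add: x_def powr_powr powr_add[symmetric])
        then show ?thesis by (simp add: a_def Y_def)
      qed
      also have "\<dots> \<le> real (card G) * (Y / 4)"
        unfolding G_def using c(2)[OF x(1)] Y by (intro mult_right_mono) auto
      finally show ?thesis by simp
    qed
    also have "\<dots> \<le> C / y ^ (3 * k)"
      unfolding C_def using a y by (intro exp_minus_powr_bound) auto
    finally show "(\<Prod>p\<in>S. norm (geo_char (exp (- (1 / y ^ k))) (p ^ k) \<theta>)) \<le> C / y ^ (3 * k)"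
      using le by (simp add: t_def)
  qed (use a in \<open>auto simp: C_def\<close>)
qed

text \<open>The threshold y powr (-5k/6) serves both sides: above it t / |\<theta>| is at most y
  powr (-k/6), and below it the primes up to y powr (5/6) have angles p^k |\<theta>| \<le>
  1.\<close>

lemma char_far:
  assumes k: "k \<ge> 1"
  obtains C y0 where "C > 0" "y0 \<ge> 1"
    "\<And>y S \<theta>. y \<ge> y0 \<Longrightarrow> finite S \<Longrightarrow> 0 \<notin> S \<Longrightarrow> {p. prime p \<and> real p \<le> y} \<subseteq> S \<Longrightarrow> \<bar>\<theta>\<bar> \<le> pi \<Longrightarrow>
       1 \<le> 1440 * y ^ (3 * k + 1) * \<bar>\<theta>\<bar> ^ 3 \<Longrightarrow>
       (\<Prod>p\<in>S. norm (geo_char (exp (- (1 / y ^ k))) (p ^ k) \<theta>)) \<le> C / y ^ (3 * k)"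
proof -
  obtain C1 y1 where 1: "C1 > 0" "y1 \<ge> 1"
    "\<And>y S \<theta>. y \<ge> y1 \<Longrightarrow> finite S \<Longrightarrow> 0 \<notin> S \<Longrightarrow> {p. prime p \<and> real p \<le> y} \<subseteq> S \<Longrightarrow> \<bar>\<theta>\<bar> \<le> pi \<Longrightarrow>
       y powr (- (5 * k / 6)) \<le> \<bar>\<theta>\<bar> \<Longrightarrow>
       (\<Prod>p\<in>S. norm (geo_char (exp (- (1 / y ^ k))) (p ^ k) \<theta>)) \<le> C1 / y ^ (3 * k)"
    using char_far_outer[OF k] by blast
  obtain C2 y2 where 2: "C2 > 0" "y2 \<ge> 1"
    "\<And>y S \<theta>. y \<ge> y2 \<Longrightarrow> finite S \<Longrightarrow> 0 \<notin> S \<Longrightarrow> {p. prime p \<and> real p \<le> y} \<subseteq> S \<Longrightarrow> \<bar>\<theta>\<bar> \<le> pi \<Longrightarrow>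
       1 \<le> 1440 * y ^ (3 * k + 1) * \<bar>\<theta>\<bar> ^ 3 \<Longrightarrow> \<bar>\<theta>\<bar> \<le> y powr (- (5 * k / 6)) \<Longrightarrow>
       (\<Prod>p\<in>S. norm (geo_char (exp (- (1 / y ^ k))) (p ^ k) \<theta>)) \<le> C2 / y ^ (3 * k)"
    using char_far_inner[OF k] by blast
  show ?thesis
  proof (rule that[of "max C1 C2" "max y1 y2"])
    fix y \<theta> :: real and S :: "nat set"
    assume y: "y \<ge> max y1 y2" and S: "finite S" "0 \<notin> S" "{p. prime p \<and> real p \<le> y} \<subseteq> S"
      and \<theta>: "\<bar>\<theta>\<bar> \<le> pi" "1 \<le> 1440 * y ^ (3 * k + 1) * \<bar>\<theta>\<bar> ^ 3"
    have y0: "y \<ge> 1" "y \<ge> y1" "y \<ge> y2" using y 1 by auto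
    have *: "C1 / y ^ (3 * k) \<le> max C1 C2 / y ^ (3 * k)" "C2 / y ^ (3 * k) \<le> max C1 C2 / y ^ (3 * k)"
      using y0 by (auto intro!: divide_right_mono)
    show "(\<Prod>p\<in>S. norm (geo_char (exp (- (1 / y ^ k))) (p ^ k) \<theta>)) \<le> max C1 C2 / y ^ (3 * k)"
    proof (cases "y powr (- (5 * k / 6)) \<le> \<bar>\<theta>\<bar>")
      case True
      show ?thesis using 1(3)[OF y0(2) S \<theta>(1) True] *(1) by linarith
    next
      case False
      then have "\<bar>\<theta>\<bar> \<le> y powr (- (5 * k / 6))" by simp
      from 2(3)[OF y0(3) S \<theta> this] *(2) show ?thesis by linarith
    qed
  qed (use 1 2 in auto)
qed

section \<open>The local limit theorem for finite sets of primes\<close>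

text \<open>The factors 1 - r^m normalise each 1 / (1 - (r cis \<theta>)^m) to
  \<open>geo_char\<close>, so the left side is 2 pi times a probability. This holds for every
  \<open>r\<close> in (0, 1); its choice matters only through the mean.\<close>

lemma parts_count_eq_integral:
  assumes r: "0 < r" "r < 1" and M: "finite M" "0 \<notin> M"
  shows "complex_of_real (2 * pi * (real (parts_count M n) * r ^ n * (\<Prod>m\<in>M. 1 - r ^ m)))
    = integral {-pi..pi} (\<lambda>\<theta>. (\<Prod>m\<in>M. geo_char r m \<theta>) * cis (- (real n * \<theta>)))"
proof -
  define c where "c = r ^ n * (\<Prod>m\<in>M. 1 - r ^ m)"
  have *: "(\<Prod>m\<in>M. geo_char r m \<theta>) * cis (- (real n * \<theta>)) =
      of_real c * ((\<Prod>m\<in>M. 1 / (1 - (of_real r * cis \<theta>) ^ m)) * (of_real r * cis \<theta>) powi (- int n))" for \<theta>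
  proof -
    have 1: "geo_char r m \<theta> = of_real (1 - r ^ m) * (1 / (1 - (of_real r * cis \<theta>) ^ m))" for m
      by (simp add: geo_char_def power_mult_distrib Complex.DeMoivre)
    have 2: "(of_real r * cis \<theta>) powi (- int n) = (1 / of_real (r ^ n)) * cis (- (real n * \<theta>))"
      by (simp add: power_int_mult_distrib cis_power_int power_int_minus inverse_eq_divide)
        (simp add: Complex.DeMoivre cis_inverse[symmetric] inverse_eq_divide power_mult_distrib)
    have 3: "(\<Prod>m\<in>M. geo_char r m \<theta>) = of_real (\<Prod>m\<in>M. 1 - r ^ m) * (\<Prod>m\<in>M. 1 / (1 - (of_real r * cis \<theta>) ^ m))"
      unfolding 1 prod.distrib of_real_prod ..
    have "complex_of_real (r ^ n) \<noteq> 0" using r by simp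
    then show ?thesis unfolding 2 3 c_def of_real_mult by (simp only: mult_ac times_divide_eq_right times_divide_eq_left mult_1) simp
  qed
  have "integral {-pi..pi} (\<lambda>\<theta>. (\<Prod>m\<in>M. geo_char r m \<theta>) * cis (- (real n * \<theta>))) = of_real c * gen_coeff r M (int n)"
    unfolding gen_coeff_def * by (rule integral_mult_right)
  also have "\<dots> = of_real c * (2 * of_real pi * of_nat (parts_count M n))"
    unfolding gen_coeff_eq_parts_count[OF r M] ..
  also have "\<dots> = complex_of_real (2 * pi * (real (parts_count M n) * r ^ n * (\<Prod>m\<in>M. 1 - r ^ m)))"
    unfolding c_def by (simp only: of_real_mult of_real_of_nat_eq mult_ac of_real_numeral)
  finally show ?thesis ..
qed

lemma norm_cis_diff: "norm (cis a - cis b) \<le> \<bar>a - b\<bar>"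
proof -
  have "cis a - cis b = cis b * (cis (a - b) - 1)" by (simp add: cis_mult right_diff_distrib)
  then have "norm (cis a - cis b) = norm (cis (a - b) - 1)" by (simp add: norm_mult)
  also have "\<dots> \<le> \<bar>a - b\<bar>" using iexp_approx1[of "a - b" 0] by (simp add: cis_conv_exp)
  finally show ?thesis .
qed

lemma continuous_on_geo_char:
  assumes "0 < r" "r < 1" "m > 0"
  shows "continuous_on A (geo_char r m)"
proof -
  have "1 - of_real (r ^ m) * cis (real m * \<theta>) \<noteq> 0" for \<theta>
    using one_minus_power_nonzero[OF assms, of \<theta>] by (simp add: power_mult_distrib Complex.DeMoivre)
  then show ?thesis unfolding geo_char_def by (intro continuous_intros) auto
qed

text \<open>The mean \<mu> of the finite model need not be \<open>n\<close>. Replacing cis (-n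
  \<theta>) by cis (-\<mu> \<theta>) costs at most pi |n - \<mu>| pointwise; this is crude, but it
  vanishes in the limit over \<open>S\<close>. That limit is possible because \<open>C\<close> and
  \<open>y0\<close> are chosen before \<open>S\<close>.\<close>

lemma finite_saddle_point:
  assumes k: "k \<ge> 1"
  obtains C y0 where "C > 0" "y0 \<ge> 2"
    "\<And>y S n r V. y \<ge> y0 \<Longrightarrow> finite S \<Longrightarrow> 0 \<notin> S \<Longrightarrow> {p. prime p \<and> real p \<le> y} \<subseteq> S \<Longrightarrow>
       r = exp (- (1 / y ^ k)) \<Longrightarrow> V = (\<Sum>p\<in>S. cum 2 r (p ^ k)) \<Longrightarrow>
       \<bar>real (parts_count ((\<lambda>p. p ^ k) ` S) n) * r ^ n * (\<Prod>p\<in>S. 1 - r ^ (p ^ k)) - 1 / sqrt (2 * pi * V)\<bar>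
       \<le> 1440 * y ^ (3 * k + 1) / V\<^sup>2 + C / y ^ (3 * k) + pi * \<bar>real n - (\<Sum>p\<in>S. cum 1 r (p ^ k))\<bar>"
proof -
  obtain C y1 where 1: "C > 0" "y1 \<ge> 1"
    "\<And>y S \<theta>. y \<ge> y1 \<Longrightarrow> finite S \<Longrightarrow> 0 \<notin> S \<Longrightarrow> {p. prime p \<and> real p \<le> y} \<subseteq> S \<Longrightarrow> \<bar>\<theta>\<bar> \<le> pi \<Longrightarrow>
       1 \<le> 1440 * y ^ (3 * k + 1) * \<bar>\<theta>\<bar> ^ 3 \<Longrightarrow>
       (\<Prod>p\<in>S. norm (geo_char (exp (- (1 / y ^ k))) (p ^ k) \<theta>)) \<le> C / y ^ (3 * k)"
    using char_far[OF k] by blast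
  show ?thesis
  proof (rule that[of C "max 2 y1"])
    fix y r V :: real and S :: "nat set" and n
    assume y: "y \<ge> max 2 y1" and S: "finite S" "0 \<notin> S" "{p. prime p \<and> real p \<le> y} \<subseteq> S"
      and r_def: "r = exp (- (1 / y ^ k))" and V_def: "V = (\<Sum>p\<in>S. cum 2 r (p ^ k))"
    have r: "0 < r" "r < 1" using y by (auto simp: r_def)
    define M where "M = (\<lambda>p. p ^ k) ` S"
    have inj: "inj_on (\<lambda>p. p ^ k) S"
      using k by (auto simp: inj_on_def power_eq_iff_eq_base)
    have M: "finite M" "0 \<notin> M" using S k by (auto simp: M_def)
    have reindex: "(\<Sum>m\<in>M. g m) = (\<Sum>p\<in>S. g (p ^ k))" for g :: "nat \<Rightarrow> real"
      unfolding M_def using inj by (subst sum.reindex) (auto simp: o_def)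
    have reindexp: "(\<Prod>m\<in>M. g m) = (\<Prod>p\<in>S. g (p ^ k))" for g :: "nat \<Rightarrow> real"
      unfolding M_def using inj by (subst prod.reindex) (auto simp: o_def)
    define \<mu> where "\<mu> = (\<Sum>m\<in>M. cum 1 r m)"
    have V: "V = (\<Sum>m\<in>M. cum 2 r m)" by (simp add: V_def reindex)
    have V0: "V > 0" unfolding V_def
    proof (rule sum_pos2[OF S(1)])
      \<comment> \<open>The single prime 2 makes the variance positive, hence the requirement
        \<open>y \<ge> 2\<close>.\<close>
      show "2 \<in> S" using S(3) y by auto
      have "r ^ (2 ^ k) < 1" using r by (simp add: power_less_one_iff)
      then show "0 < cum 2 r (2 ^ k)" using r unfolding cum_def
        by (intro divide_pos_pos mult_pos_pos zero_less_power) auto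
    qed (use r in \<open>auto intro: cum_nonneg\<close>)
    define K where "K = 1440 * y ^ (3 * k + 1)"
    have K1: "K \<ge> 1"
    proof -
      have "1 \<le> y ^ (3 * k + 1)" using y by (intro one_le_power) auto
      then show ?thesis by (simp add: K_def)
    qed
    have K: "(\<Sum>m\<in>M. cum 3 r m) \<le> K"
      unfolding reindex K_def r_def using sum_cum_upper[of y k S 3] y k S by (simp add: mult.commute)
    define \<phi> where "\<phi> \<theta> = (\<Prod>m\<in>M. geo_char r m \<theta>)" for \<theta>
    have m0: "m > 0" if "m \<in> M" for m using that M(2) by (metis gr0I)
    have \<phi>c: "continuous_on A \<phi>" for A
      unfolding \<phi>_def by (intro continuous_on_prod continuous_on_geo_char r m0)
    have \<phi>1: "norm (\<phi> \<theta>) \<le> 1" for \<theta>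
      unfolding \<phi>_def prod_norm[symmetric] by (intro prod_le_1) (auto intro!: norm_geo_char_le_1 r m0)
    have main: "norm (integral {-pi..pi} (\<lambda>\<theta>. \<phi> \<theta> * cis (- (\<mu> * \<theta>))) - of_real (sqrt (2 * pi / V)))
      \<le> 4 * K / V\<^sup>2 + 2 * pi * (C / y ^ (3 * k))"
    proof (rule gaussian_comparison[OF V0 K1])
      show "continuous_on {- pi..pi} (\<lambda>\<theta>. \<phi> \<theta> * cis (- (\<mu> * \<theta>)))"
        by (intro continuous_intros \<phi>c)
      show "norm (\<phi> \<theta> * cis (- (\<mu> * \<theta>)) - of_real (exp (- (V * \<theta>\<^sup>2 / 2)))) \<le> K * \<bar>\<theta>\<bar> ^ 3 * exp (- (V * \<theta>\<^sup>2 / 2))"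
        if "K * \<bar>\<theta>\<bar> ^ 3 \<le> 1" for \<theta>
        unfolding \<phi>_def \<mu>_def V using r M K that by (rule prod_geo_char_approx)
      show "norm (\<phi> \<theta> * cis (- (\<mu> * \<theta>))) \<le> C / y ^ (3 * k)" if "\<bar>\<theta>\<bar> \<le> pi" "1 \<le> K * \<bar>\<theta>\<bar> ^ 3" for \<theta>
      proof -
        have "norm (\<phi> \<theta> * cis (- (\<mu> * \<theta>))) = (\<Prod>p\<in>S. norm (geo_char r (p ^ k) \<theta>))"
          unfolding norm_mult norm_cis \<phi>_def prod_norm[symmetric] reindexp by simp
        also have "\<dots> \<le> C / y ^ (3 * k)"
          unfolding r_def using y that by (intro 1(3) S) (auto simp: K_def)
        finally show ?thesis .
      qed
    qed
    have shift: "norm (integral {-pi..pi} (\<lambda>\<theta>. \<phi> \<theta> * cis (- (real n * \<theta>))) - integral {-pi..pi} (\<lambda>\<theta>. \<phi> \<theta> * cis (- (\<mu> * \<theta>))))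
      \<le> (\<bar>real n - \<mu>\<bar> * pi) * (pi - (- pi))"
    proof -
      have "integral {-pi..pi} (\<lambda>\<theta>. \<phi> \<theta> * cis (- (real n * \<theta>))) - integral {-pi..pi} (\<lambda>\<theta>. \<phi> \<theta> * cis (- (\<mu> * \<theta>)))
        = integral {-pi..pi} (\<lambda>\<theta>. \<phi> \<theta> * cis (- (real n * \<theta>)) - \<phi> \<theta> * cis (- (\<mu> * \<theta>)))"
        by (intro integral_diff[symmetric] integrable_continuous_interval continuous_intros \<phi>c)
      moreover have "norm (integral {-pi..pi} (\<lambda>\<theta>. \<phi> \<theta> * cis (- (real n * \<theta>)) - \<phi> \<theta> * cis (- (\<mu> * \<theta>))))
         \<le> (\<bar>real n - \<mu>\<bar> * pi) * (pi - (- pi))"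
      proof (rule integral_bound)
        show "continuous_on {- pi..pi} (\<lambda>\<theta>. \<phi> \<theta> * cis (- (real n * \<theta>)) - \<phi> \<theta> * cis (- (\<mu> * \<theta>)))"
          by (intro continuous_intros \<phi>c)
        fix \<theta> :: real assume \<theta>: "\<theta> \<in> {-pi..pi}"
        have "norm (\<phi> \<theta> * cis (- (real n * \<theta>)) - \<phi> \<theta> * cis (- (\<mu> * \<theta>))) =
            norm (\<phi> \<theta>) * norm (cis (- (real n * \<theta>)) - cis (- (\<mu> * \<theta>)))"
          by (simp only: right_diff_distrib[symmetric] norm_mult)
        also have "\<dots> \<le> 1 * \<bar>- (real n * \<theta>) - - (\<mu> * \<theta>)\<bar>"
          by (intro mult_mono \<phi>1 norm_cis_diff) auto
        also have "\<bar>- (real n * \<theta>) - - (\<mu> * \<theta>)\<bar> = \<bar>real n - \<mu>\<bar> * \<bar>\<theta>\<bar>"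
          by (simp add: abs_mult[symmetric] algebra_simps abs_minus_commute)
        also have "1 * \<dots> \<le> \<bar>real n - \<mu>\<bar> * pi" using \<theta> by (auto intro!: mult_left_mono)
        finally show "norm (\<phi> \<theta> * cis (- (real n * \<theta>)) - \<phi> \<theta> * cis (- (\<mu> * \<theta>))) \<le> \<bar>real n - \<mu>\<bar> * pi" .
      qed auto
      ultimately show ?thesis by (simp only:)
    qed
    define X where "X = real (parts_count M n) * r ^ n * (\<Prod>m\<in>M. 1 - r ^ m)"
    have X: "complex_of_real (2 * pi * X) = integral {-pi..pi} (\<lambda>\<theta>. \<phi> \<theta> * cis (- (real n * \<theta>)))"
      unfolding X_def \<phi>_def by (rule parts_count_eq_integral[OF r M])
    have "\<bar>2 * pi * X - sqrt (2 * pi / V)\<bar> = norm (complex_of_real (2 * pi * X) - of_real (sqrt (2 * pi / V)))"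
      by (simp only: of_real_diff[symmetric] norm_of_real)
    also have "\<dots> \<le> (4 * K / V\<^sup>2 + 2 * pi * (C / y ^ (3 * k))) + (\<bar>real n - \<mu>\<bar> * pi) * (pi - (- pi))"
      unfolding X using norm_triangle_mono[OF shift main] by (simp add: add.commute)
    finally have "\<bar>2 * pi * X - sqrt (2 * pi / V)\<bar> / (2 * pi)
       \<le> ((4 * K / V\<^sup>2 + 2 * pi * (C / y ^ (3 * k))) + (\<bar>real n - \<mu>\<bar> * pi) * (pi - (- pi))) / (2 * pi)"
      by (intro divide_right_mono) auto
    also have "\<dots> = (2 / pi) * (K / V\<^sup>2) + C / y ^ (3 * k) + pi * \<bar>real n - \<mu>\<bar>"
      by (simp add: add_divide_distrib)
    also have "\<dots> \<le> 1 * (K / V\<^sup>2) + C / y ^ (3 * k) + pi * \<bar>real n - \<mu>\<bar>"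
      using K1 pi_ge_two by (intro add_mono mult_right_mono) auto
    finally have "\<bar>2 * pi * X - sqrt (2 * pi / V)\<bar> / (2 * pi) \<le> 1 * (K / V\<^sup>2) + C / y ^ (3 * k) + pi * \<bar>real n - \<mu>\<bar>" .
    moreover have "\<bar>2 * pi * X - sqrt (2 * pi / V)\<bar> / (2 * pi) = \<bar>X - 1 / sqrt (2 * pi * V)\<bar>"
    proof -
      have "sqrt (2 * pi / V) = 2 * pi * (1 / sqrt (2 * pi * V))"
      proof -
        have "sqrt (2 * pi / V) * sqrt (2 * pi * V) = sqrt ((2 * pi)\<^sup>2)"
          unfolding real_sqrt_mult[symmetric] using V0 by (simp add: power2_eq_square)
        also have "\<dots> = 2 * pi" unfolding real_sqrt_abs by simp
        finally have "sqrt (2 * pi / V) * sqrt (2 * pi * V) = 2 * pi" .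
        then show ?thesis using V0 by (simp add: field_simps)
      qed
      then have "2 * pi * X - sqrt (2 * pi / V) = 2 * pi * (X - 1 / sqrt (2 * pi * V))"
        by (simp only: right_diff_distrib)
      then show ?thesis by (simp add: abs_mult)
    qed
    ultimately show "\<bar>real (parts_count ((\<lambda>p. p ^ k) ` S) n) * r ^ n * (\<Prod>p\<in>S. 1 - r ^ (p ^ k)) - 1 / sqrt (2 * pi * V)\<bar>
       \<le> 1440 * y ^ (3 * k + 1) / V\<^sup>2 + C / y ^ (3 * k) + pi * \<bar>real n - (\<Sum>p\<in>S. cum 1 r (p ^ k))\<bar>"
      unfolding X_def K_def \<mu>_def reindex reindexp M_def[symmetric] by simp
  qed (use 1 in auto)
qed

section \<open>The saddle point\<close>

text \<open>\<open>y\<close> is the scale at which r^(y^k) = 1/e: for primes up to \<open>y\<close>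
  the power r^(p^k) is bounded below, beyond it fades out.\<close>

lemma exp_root_param:
  fixes r :: real
  assumes "0 < r" "r < 1" "k \<ge> 1"
  obtains y where "y > 0" "r = exp (- (1 / y ^ k))"
proof
  let ?y = "(- ln r) powr (- 1 / real k)"
  show "?y > 0" using assms by simp
  have "?y ^ k = (- ln r) powr (- 1)"
    using assms by (simp add: powr_realpow[symmetric] powr_powr)
  also have "\<dots> = 1 / (- ln r)" using assms by (simp add: powr_minus inverse_eq_divide)
  finally show "r = exp (- (1 / ?y ^ k))" using assms by simp
qed

text \<open>Extended by 0 off the primes, so that series over all naturals apply. The sum over p is
  the mean for \<open>i = 1\<close> and the variance for \<open>i = 2\<close>.\<close>

definition prime_cum :: "nat \<Rightarrow> nat \<Rightarrow> real \<Rightarrow> nat \<Rightarrow> real" where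
  "prime_cum k i r p = (if prime p then cum i r (p ^ k) else 0)"

lemma prime_cum_nonneg: "0 < r \<Longrightarrow> r < 1 \<Longrightarrow> 0 \<le> prime_cum k i r p"
  by (simp add: prime_cum_def cum_nonneg)

lemma sum_prime_cum: "(\<Sum>p<N. prime_cum k i r p) = (\<Sum>p\<in>{p. p < N \<and> prime p}. cum i r (p ^ k))"
  unfolding prime_cum_def by (subst sum.inter_filter[symmetric]) (auto intro: sum.cong)

lemma sum_prime_cum_upper:
  assumes "y > 0" "k \<ge> 1" "i \<le> 3"
  shows "(\<Sum>p<N. prime_cum k i (exp (- (1 / y ^ k))) p) \<le> 1440 * y ^ (k * i + 1)"
  unfolding sum_prime_cum using assms by (intro sum_cum_upper) auto

lemma summable_prime_cum:
  assumes "0 < r" "r < 1" "k \<ge> 1" "i \<le> 3"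
  shows "summable (prime_cum k i r)"
proof -
  obtain y where y: "y > 0" "r = exp (- (1 / y ^ k))" using exp_root_param[OF assms(1-3)] .
  show ?thesis
    using sum_prime_cum_upper[OF y(1) assms(3,4)] prime_cum_nonneg[OF assms(1,2)] unfolding y(2)[symmetric]
    by (intro summableI_nonneg_bounded) auto
qed

lemma suminf_prime_cum_upper:
  assumes "y > 0" "k \<ge> 1" "i \<le> 3"
  shows "(\<Sum>p. prime_cum k i (exp (- (1 / y ^ k))) p) \<le> 1440 * y ^ (k * i + 1)"
  using assms by (intro suminf_le_const summable_prime_cum sum_prime_cum_upper) auto

lemma suminf_prime_cum_2_lower:
  assumes y: "y > 0" "k \<ge> 1"
  shows "y ^ (2 * k) / 3 * real (card {p. prime p \<and> real p \<le> y}) \<le> (\<Sum>p. prime_cum k 2 (exp (- (1 / y ^ k))) p)"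
proof -
  let ?r = "exp (- (1 / y ^ k))" and ?N = "Suc (nat \<lfloor>y\<rfloor>)"
  have "y ^ (2 * k) / 3 * real (card {p. prime p \<and> real p \<le> y}) \<le> (\<Sum>p\<in>{p. p < ?N \<and> prime p}. cum 2 ?r (p ^ k))"
    using y by (intro sum_cum_2_lower) (auto simp: le_nat_floor less_Suc_eq_le)
  also have "\<dots> \<le> (\<Sum>p. prime_cum k 2 ?r p)"
    unfolding sum_prime_cum[symmetric] using y
    by (intro sum_le_suminf summable_prime_cum) (auto intro!: prime_cum_nonneg)
  finally show ?thesis .
qed

section \<open>Phi and Psi as series over primes, and their derivatives\<close>

definition prime_log :: "nat \<Rightarrow> real \<Rightarrow> nat \<Rightarrow> real" where
  "prime_log k r p = (if prime p then - ln (1 - r ^ (p ^ k)) else 0)"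

lemma minus_ln_one_minus_bounds:
  fixes q :: real
  assumes "0 < q" "q < 1"
  shows "0 \<le> - ln (1 - q)" "- ln (1 - q) \<le> q / (1 - q)"
proof -
  show "0 \<le> - ln (1 - q)" using assms by simp
  have "- ln (1 - q) = ln (1 / (1 - q))" using assms by (simp add: ln_div)
  also have "\<dots> \<le> 1 / (1 - q) - 1" using assms by (intro ln_le_minus_one) auto
  also have "\<dots> = q / (1 - q)" using assms by (simp add: field_simps)
  finally show "- ln (1 - q) \<le> q / (1 - q)" .
qed

text \<open>Here -ln (1 - q) \<le> q / (1 - q), and the factor p^k \<ge> 1 only enlarges the right
  side. Summability of the logarithms is thus inherited from the first cumulants.\<close>

lemma prime_log_bounds:
  assumes "0 < r" "r < 1"
  shows "0 \<le> prime_log k r p" "prime_log k r p \<le> prime_cum k 1 r p"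
proof -
  have "0 \<le> prime_log k r p \<and> prime_log k r p \<le> prime_cum k 1 r p"
  proof (cases "prime p")
    case True
    define m where "m = p ^ k"
    define q where "q = r ^ m"
    have m: "m > 0" using True by (simp add: m_def prime_gt_0_nat)
    then have q: "0 < q" "q < 1" using assms by (simp_all add: q_def power_less_one_iff)
    have "1 * (q / (1 - q)) \<le> real m * (q / (1 - q))"
      using m q by (intro mult_right_mono) simp_all
    moreover have "prime_cum k 1 r p = real m * (q / (1 - q))"
      using True by (simp add: prime_cum_def cum_def m_def q_def)
    moreover have "prime_log k r p = - ln (1 - q)"
      using True by (simp add: prime_log_def m_def q_def)
    ultimately show ?thesis using minus_ln_one_minus_bounds[OF q] by linarith
  qed (simp add: prime_log_def prime_cum_def)
  then show "0 \<le> prime_log k r p" "prime_log k r p \<le> prime_cum k 1 r p" by blast+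
qed

lemma summable_prime_log:
  assumes "0 < r" "r < 1" "k \<ge> 1"
  shows "summable (prime_log k r)"
proof (rule summable_comparison_test')
  show "summable (prime_cum k 1 r)" using assms by (intro summable_prime_cum) simp_all
  show "norm (prime_log k r p) \<le> prime_cum k 1 r p" if "p \<ge> 0" for p
    using prime_log_bounds[OF assms(1,2), of k p] by simp
qed

lemma Phi_eq:
  assumes "0 < z" "z < 1"
  shows "Phi k z = (\<Sum>p. prime_log k z p)"
proof -
  have "(\<Sum>j. z ^ (Suc j * p ^ k) / real (Suc j)) = - ln (1 - z ^ (p ^ k))" if "prime p" for p
  proof -
    define q where "q = z ^ (p ^ k)"
    have q: "0 < q" "q < 1" using assms that by (auto simp: q_def power_less_one_iff prime_gt_0_nat)
    have "(\<lambda>n. q ^ n / real n) sums - ln (1 - q)"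
      using ln_series'[of "- q"] q sums_minus[of "\<lambda>n. - (q ^ n / real n)" "ln (1 - q)"] by simp
    then have "(\<lambda>j. q ^ Suc j / real (Suc j)) sums - ln (1 - q)"
      by (subst sums_Suc_iff) simp
    moreover have "q ^ Suc j = z ^ (Suc j * p ^ k)" for j
      unfolding q_def by (simp only: power_mult[symmetric] mult.commute)
    ultimately have "(\<lambda>j. z ^ (Suc j * p ^ k) / real (Suc j)) sums - ln (1 - q)" by (simp only:)
    then show ?thesis unfolding q_def by (rule sums_unique[symmetric])
  qed
  then show ?thesis unfolding Phi_def prime_log_def by (simp cong: if_cong)
qed

lemma Psi_eq:
  assumes "0 < z" "z < 1" "k \<ge> 1"
  shows "Psi k z = exp (\<Sum>p. prime_log k z p)"
proof -
  have "(if prime p then 1 / (1 - z ^ (p ^ k)) else 1) = exp (prime_log k z p)" for p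
  proof (cases "prime p")
    case True
    then have "z ^ (p ^ k) < 1" using assms by (simp add: power_less_one_iff prime_gt_0_nat)
    then show ?thesis by (simp add: True prime_log_def exp_minus inverse_eq_divide)
  qed (simp add: prime_log_def)
  then show ?thesis unfolding Psi_def using prodinf_exp[OF summable_prime_log[OF assms]] by simp
qed

lemma prime_product_limit:
  assumes "0 < z" "z < 1" "k \<ge> 1"
  shows "(\<lambda>N. \<Prod>p\<in>{p. p < N \<and> prime p}. 1 - z ^ (p ^ k)) \<longlonglongrightarrow> 1 / Psi k z"
proof -
  have "(\<Prod>p\<in>{p. p < N \<and> prime p}. 1 - z ^ (p ^ k)) = exp (- (\<Sum>p<N. prime_log k z p))" for N
  proof -
    have "(\<Sum>p<N. prime_log k z p) = (\<Sum>p\<in>{p. p < N \<and> prime p}. - ln (1 - z ^ (p ^ k)))"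
      unfolding prime_log_def by (subst sum.inter_filter[symmetric]) (auto intro: sum.cong)
    then have "exp (- (\<Sum>p<N. prime_log k z p)) = (\<Prod>p\<in>{p. p < N \<and> prime p}. exp (ln (1 - z ^ (p ^ k))))"
      by (simp add: sum_negf exp_sum)
    also have "\<dots> = (\<Prod>p\<in>{p. p < N \<and> prime p}. 1 - z ^ (p ^ k))"
      using assms by (intro prod.cong) (auto simp: power_less_one_iff prime_gt_0_nat)
    finally show ?thesis ..
  qed
  moreover have "(\<lambda>N. exp (- (\<Sum>p<N. prime_log k z p))) \<longlonglongrightarrow> exp (- (\<Sum>p. prime_log k z p))"
    by (intro tendsto_intros summable_LIMSEQ summable_prime_log assms)
  ultimately show ?thesis
    using assms by (simp add: Psi_eq exp_minus inverse_eq_divide)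
qed

text \<open>Weierstrass' M-test on (0, b) with x < b < 1. Hypothesis \<open>mono\<close> makes the
  value at b a majorant; it fits derivatives that are power series with nonnegative coefficients, as
  all those below are.\<close>

lemma suminf_has_derivative_dominated:
  fixes f f' :: "nat \<Rightarrow> real \<Rightarrow> real"
  assumes x: "0 < x" "x < 1"
    and deriv: "\<And>p x. 0 < x \<Longrightarrow> x < 1 \<Longrightarrow> (f p has_real_derivative f' p x) (at x)"
    and mono: "\<And>p x b. 0 < x \<Longrightarrow> x \<le> b \<Longrightarrow> b < 1 \<Longrightarrow> \<bar>f' p x\<bar> \<le> f' p b"
    and sum: "\<And>x. 0 < x \<Longrightarrow> x < 1 \<Longrightarrow> summable (\<lambda>p. f p x)" "\<And>x. 0 < x \<Longrightarrow> x < 1 \<Longrightarrow> summable (\<lambda>p. f' p x)"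
  shows "((\<lambda>x. \<Sum>p. f p x) has_real_derivative (\<Sum>p. f' p x)) (at x)"
proof -
  define b where "b = (1 + x) / 2"
  have b: "0 < b" "x < b" "b < 1" using x by (auto simp: b_def)
  show ?thesis
  proof (rule has_field_derivative_series'(2)[where S = "{0<..<b}"])
    show "uniformly_convergent_on {0<..<b} (\<lambda>n x. \<Sum>i<n. f' i x)"
      using b by (intro Weierstrass_m_test'[where M = "\<lambda>p. f' p b"]) (auto intro!: mono sum)
    show "(f n has_real_derivative f' n y) (at y within {0<..<b})" if "y \<in> {0<..<b}" for n y
      using that b by (intro DERIV_subset[OF deriv]) auto
    show "summable (\<lambda>n. f n x)" using sum x by blast
  qed (use x b in \<open>auto simp: interior_open\<close>)
qed

lemma power_quotient_mono:
  fixes x b :: real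
  assumes "0 < x" "x \<le> b" "b < 1" "m > 0"
  shows "\<bar>c ^ i * x ^ (m - 1) / (1 - x ^ m) ^ i\<bar> \<le> \<bar>c\<bar> ^ i * b ^ (m - 1) / (1 - b ^ m) ^ i"
proof -
  have "x ^ m \<le> b ^ m" using assms by (intro power_mono) auto
  moreover have "b ^ m < 1" using assms by (simp add: power_less_one_iff)
  ultimately have "\<bar>1 - x ^ m\<bar> = 1 - x ^ m" by simp
  then have "\<bar>c ^ i * x ^ (m - 1) / (1 - x ^ m) ^ i\<bar> = \<bar>c\<bar> ^ i * x ^ (m - 1) / (1 - x ^ m) ^ i"
    using assms by (simp add: abs_mult power_abs)
  also have "\<dots> \<le> \<bar>c\<bar> ^ i * b ^ (m - 1) / (1 - b ^ m) ^ i"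
    using assms \<open>x ^ m \<le> b ^ m\<close> \<open>b ^ m < 1\<close> by (intro frac_le mult_left_mono power_mono) auto
  finally show ?thesis .
qed

lemma cum_div: "m > 0 \<Longrightarrow> x \<noteq> 0 \<Longrightarrow> cum i x m / x = real m ^ i * x ^ (m - 1) / (1 - x ^ m) ^ i"
  by (cases m) (auto simp: cum_def)

lemma prime_cum_div_mono:
  assumes "0 < x" "x \<le> b" "b < 1"
  shows "\<bar>prime_cum k i x p / x\<bar> \<le> prime_cum k i b p / b"
proof (cases "prime p")
  case True
  then have "p ^ k > 0" by (simp add: prime_gt_0_nat)
  from power_quotient_mono[OF assms this, of "real (p ^ k)" i] this assms True
  show ?thesis by (simp only: prime_cum_def if_True cum_div abs_of_nat less_imp_neq[symmetric] less_imp_neq[of 0, symmetric]) (simp add: cum_div)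
qed (simp add: prime_cum_def)

lemma Phi_deriv:
  assumes x: "0 < x" "x < 1" and k: "k \<ge> 1"
  shows "x * deriv (Phi k) x = (\<Sum>p. prime_cum k 1 x p)"
proof -
  have "((\<lambda>x. \<Sum>p. prime_log k x p) has_real_derivative (\<Sum>p. prime_cum k 1 x p / x)) (at x)"
  proof (rule suminf_has_derivative_dominated[OF x, where f = "\<lambda>p x. prime_log k x p"])
    show "((\<lambda>x. prime_log k x p) has_real_derivative prime_cum k 1 z p / z) (at z)" if z: "0 < z" "z < 1" for p z
    proof (cases "prime p")
      case True
      then have m: "p ^ k > 0" "z ^ (p ^ k) < 1" using z by (auto simp: prime_gt_0_nat power_less_one_iff)
      have "((\<lambda>x. - ln (1 - x ^ (p ^ k))) has_real_derivative real (p ^ k) * z ^ (p ^ k - 1) / (1 - z ^ (p ^ k))) (at z)"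
        using m by (auto intro!: derivative_eq_intros)
      moreover have "prime_cum k 1 z p / z = real (p ^ k) * z ^ (p ^ k - 1) / (1 - z ^ (p ^ k))"
        using True z cum_div[OF m(1), of z 1] by (simp add: prime_cum_def)
      ultimately show ?thesis using True unfolding prime_log_def by simp
    qed (simp add: prime_log_def prime_cum_def)
    show "\<bar>prime_cum k 1 z p / z\<bar> \<le> prime_cum k 1 b p / b" if "0 < z" "z \<le> b" "b < 1" for p z b
      using that by (rule prime_cum_div_mono)
    show "summable (\<lambda>p. prime_log k z p)" if "0 < z" "z < 1" for z
      using that k by (rule summable_prime_log)
    show "summable (\<lambda>p. prime_cum k 1 z p / z)" if "0 < z" "z < 1" for z
      using that k by (intro summable_divide summable_prime_cum) auto
  qed
  then have "(Phi k has_real_derivative (\<Sum>p. prime_cum k 1 x p / x)) (at x)"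
    by (rule has_field_derivative_transform_within_open[where S = "{0<..<1}"]) (use x in \<open>auto simp: Phi_eq\<close>)
  then have "deriv (Phi k) x = (\<Sum>p. prime_cum k 1 x p / x)" by (rule DERIV_imp_deriv)
  also have "\<dots> = (\<Sum>p. prime_cum k 1 x p) / x"
    using x k by (intro suminf_divide summable_prime_cum) auto
  finally show ?thesis using x by simp
qed

text \<open>The operator x d/dx sends m x^m / (1 - x^m) to m^2 x^m / (1 - x^m)^2, turning means into
  variances.\<close>

lemma prime_cum_1_has_derivative:
  assumes x: "0 < x" "x < 1" and k: "k \<ge> 1"
  shows "((\<lambda>x. \<Sum>p. prime_cum k 1 x p) has_real_derivative (\<Sum>p. prime_cum k 2 x p) / x) (at x)"
proof -
  have "((\<lambda>x. \<Sum>p. prime_cum k 1 x p) has_real_derivative (\<Sum>p. prime_cum k 2 x p / x)) (at x)"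
  proof (rule suminf_has_derivative_dominated[OF x, where f = "\<lambda>p x. prime_cum k 1 x p"])
    show "((\<lambda>x. prime_cum k 1 x p) has_real_derivative prime_cum k 2 z p / z) (at z)" if z: "0 < z" "z < 1" for p z
    proof (cases "prime p")
      case True
      define m where "m = p ^ k"
      have m: "m > 0" "z ^ m < 1" using z True by (auto simp: m_def prime_gt_0_nat power_less_one_iff)
      have e: "real m * (real m * z ^ (m - 1)) * (1 - z ^ m) - real m * z ^ m * (0 - real m * z ^ (m - 1))
          = real m ^ 2 * z ^ (m - 1)"
        by (simp add: algebra_simps power2_eq_square)
      have "((\<lambda>x. real m * x ^ m / (1 - x ^ m)) has_real_derivative
         (real m * (real m * z ^ (m - 1)) * (1 - z ^ m) - real m * z ^ m * (0 - real m * z ^ (m - 1))) / ((1 - z ^ m) * (1 - z ^ m))) (at z)"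
        using m by (auto intro!: derivative_eq_intros)
      then have "((\<lambda>x. real m * x ^ m / (1 - x ^ m)) has_real_derivative cum 2 z m / z) (at z)"
        unfolding e using cum_div[OF m(1), of z 2] z by (simp add: power2_eq_square)
      moreover have "(\<lambda>x. prime_cum k 1 x p) = (\<lambda>x. real m * x ^ m / (1 - x ^ m))"
        using True by (simp add: prime_cum_def m_def cum_def)
      moreover have "prime_cum k 2 z p = cum 2 z m" using True by (simp add: prime_cum_def m_def)
      ultimately show ?thesis by (simp only:)
    qed (simp add: prime_cum_def)
    show "\<bar>prime_cum k 2 z p / z\<bar> \<le> prime_cum k 2 b p / b" if "0 < z" "z \<le> b" "b < 1" for p z b
      using that by (rule prime_cum_div_mono)
    show "summable (\<lambda>p. prime_cum k 1 z p)" if "0 < z" "z < 1" for z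
      using that k by (intro summable_prime_cum) auto
    show "summable (\<lambda>p. prime_cum k 2 z p / z)" if "0 < z" "z < 1" for z
      using that k by (intro summable_divide summable_prime_cum) auto
  qed
  also have "(\<Sum>p. prime_cum k 2 x p / x) = (\<Sum>p. prime_cum k 2 x p) / x"
    using x k by (intro suminf_divide summable_prime_cum) auto
  finally show ?thesis .
qed

lemma Phi2_eq:
  assumes x: "0 < x" "x < 1" and k: "k \<ge> 1"
  shows "Phi2 k x = (\<Sum>p. prime_cum k 2 x p)"
proof -
  have "((\<lambda>s. s * deriv (Phi k) s) has_real_derivative (\<Sum>p. prime_cum k 2 x p) / x) (at x)"
    using prime_cum_1_has_derivative[OF x k]
    by (rule has_field_derivative_transform_within_open[where S = "{0<..<1}"]) (use x k in \<open>auto simp: Phi_deriv\<close>)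
  then show ?thesis unfolding Phi2_def using x by (simp add: DERIV_imp_deriv)
qed

section \<open>Existence and uniqueness of \<rho>(n)\<close>

lemma suminf_prime_cum_2_pos:
  assumes x: "0 < x" "x < 1" and k: "k \<ge> 1"
  shows "0 < (\<Sum>p. prime_cum k 2 x p)"
proof (rule suminf_pos2)
  show "summable (prime_cum k 2 x)" using x k by (intro summable_prime_cum) simp_all
  show "0 \<le> prime_cum k 2 x n" for n using x by (rule prime_cum_nonneg)
  have "x ^ (2 ^ k) < 1" using x by (simp add: power_less_one_iff)
  then show "0 < prime_cum k 2 x 2" using x unfolding prime_cum_def cum_def
    by (simp add: zero_less_mult_iff)
qed

lemma prime_cum_1_strict_mono:
  assumes "0 < a" "a < b" "b < 1" and k: "k \<ge> 1"
  shows "(\<Sum>p. prime_cum k 1 a p) < (\<Sum>p. prime_cum k 1 b p)"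
proof (rule DERIV_pos_imp_increasing[OF assms(2)])
  fix x assume "a \<le> x" "x \<le> b"
  then have x: "0 < x" "x < 1" using assms by auto
  show "\<exists>y. ((\<lambda>x. \<Sum>p. prime_cum k 1 x p) has_real_derivative y) (at x) \<and> 0 < y"
  proof (intro exI conjI)
    show "((\<lambda>x. \<Sum>p. prime_cum k 1 x p) has_real_derivative (\<Sum>p. prime_cum k 2 x p) / x) (at x)"
      by (rule prime_cum_1_has_derivative[OF x k])
    show "0 < (\<Sum>p. prime_cum k 2 x p) / x"
      using suminf_prime_cum_2_pos[OF x k] x(1) by (rule divide_pos_pos)
  qed
qed

text \<open>exp (-1440) corresponds to y^k = 1/1440, where the general upper bound 1440 y^(k+1)
  collapses to y \<le> 1. It is a left endpoint for the intermediate value theorem that suits all n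
  \<ge> 1.\<close>

lemma prime_cum_1_small:
  assumes k: "k \<ge> 1"
  shows "(\<Sum>p. prime_cum k 1 (exp (- 1440)) p) \<le> 1"
proof -
  define y where "y = 1440 powr (- 1 / real k)"
  have y: "y > 0" by (simp add: y_def)
  have "y ^ k = 1440 powr (- 1)" using k by (simp add: y_def powr_realpow[symmetric] powr_powr)
  then have yk: "y ^ k = 1 / 1440" by (simp add: powr_minus)
  have "y \<le> 1" unfolding y_def using powr_mono[of "- 1 / real k" 0 1440] by simp
  moreover have "1440 * y ^ (k * 1 + 1) = y" by (simp add: power_add yk)
  moreover have "(\<Sum>p. prime_cum k 1 (exp (- (1 / y ^ k))) p) \<le> 1440 * y ^ (k * 1 + 1)"
    by (rule suminf_prime_cum_upper[OF y k]) simp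
  moreover have "1 / y ^ k = 1440" unfolding yk by simp
  ultimately show ?thesis by (simp only:)
qed

text \<open>The prime 2 alone suffices: b is chosen so that q = b^(2^k) equals n / (n + 1), whence q
  / (1 - q) = n.\<close>

lemma prime_cum_1_large:
  assumes k: "k \<ge> 1" and n: "n \<ge> 1"
  obtains b where "0 < b" "b < 1" "real n \<le> (\<Sum>p. prime_cum k 1 b p)"
proof
  let ?b = "(real n / (real n + 1)) powr (1 / 2 ^ k)"
  have n01: "0 < real n / (real n + 1)" "real n / (real n + 1) < 1" using n by auto
  show b: "0 < ?b" "?b < 1"
    using n n01 powr_less_mono2[of "1 / 2 ^ k" "real n / (real n + 1)" 1] by auto
  have "?b ^ (2 ^ k) = (real n / (real n + 1)) powr (1 / 2 ^ k * real (2 ^ k))"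
    by (simp only: powr_realpow[OF b(1), symmetric] powr_powr)
  also have "1 / 2 ^ k * real (2 ^ k) = 1" by simp
  also have "(real n / (real n + 1)) powr 1 = real n / (real n + 1)" using n01 by simp
  finally have bn: "?b ^ (2 ^ k) = real n / (real n + 1)" .
  have "1 - real n / (real n + 1) = 1 / (real n + 1)" by (simp add: field_simps)
  then have "prime_cum k 1 ?b 2 = 2 ^ k * real n"
    unfolding prime_cum_def cum_def by (simp add: bn)
  moreover have "1 * real n \<le> 2 ^ k * real n" by (intro mult_right_mono) auto
  moreover have "(\<Sum>p\<in>{2}. prime_cum k 1 ?b p) \<le> (\<Sum>p. prime_cum k 1 ?b p)"
  proof (rule sum_le_suminf)
    show "summable (prime_cum k 1 ?b)" using b k by (intro summable_prime_cum) simp_all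
    show "0 \<le> prime_cum k 1 ?b p" for p using b by (rule prime_cum_nonneg)
  qed simp
  ultimately show "real n \<le> (\<Sum>p. prime_cum k 1 ?b p)" by simp
qed

lemma rho_exists:
  assumes k: "k \<ge> 1" and n: "n \<ge> 1"
  shows "\<exists>r. 0 < r \<and> r < 1 \<and> (\<Sum>p. prime_cum k 1 r p) = real n"
proof -
  define G where "G x = (\<Sum>p. prime_cum k 1 x p)" for x
  define a where "a = exp (- 1440 :: real)"
  have a: "0 < a" "a < 1" "G a \<le> 1"
    using prime_cum_1_small[OF k] by (auto simp: a_def G_def)
  obtain b where b: "0 < b" "b < 1" "real n \<le> G b"
    using prime_cum_1_large[OF k n] unfolding G_def by metis
  have n1: "1 \<le> real n" using n by simp
  have ab: "a \<le> b"
  proof (rule ccontr)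
    assume "\<not> a \<le> b"
    then have "b < a" by simp
    then have "G b < G a" unfolding G_def by (intro prime_cum_1_strict_mono k b a)
    then show False using a b n1 by linarith
  qed
  have "\<exists>x\<ge>a. x \<le> b \<and> G x = real n"
  proof (rule IVT[of G a "real n" b])
    show "real n \<le> G b" "a \<le> b" by fact+
    show "G a \<le> real n" using a n1 by linarith
    show "\<forall>x. a \<le> x \<and> x \<le> b \<longrightarrow> isCont G x"
    proof (intro allI impI)
      fix x assume "a \<le> x \<and> x \<le> b"
      then have "0 < x" "x < 1" using a b by linarith+
      from DERIV_isCont[OF prime_cum_1_has_derivative[OF this k]]
      show "isCont G x" unfolding G_def .
    qed
  qed
  then obtain x where x: "a \<le> x" "x \<le> b" "G x = real n" by blast
  show ?thesis
  proof (intro exI conjI)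
    show "0 < x" "x < 1" using x a b by linarith+
    show "(\<Sum>p. prime_cum k 1 x p) = real n" using x(3) unfolding G_def .
  qed
qed

lemma rho_spec:
  assumes k: "k \<ge> 1" and n: "n \<ge> 1"
  shows "0 < rho k n" "rho k n < 1" "(\<Sum>p. prime_cum k 1 (rho k n) p) = real n"
proof -
  define P where "P r \<longleftrightarrow> 0 < r \<and> r < 1 \<and> (\<Sum>p. prime_cum k 1 r p) = real n" for r
  have "\<exists>!r. P r"
  proof (rule ex_ex1I)
    show "\<exists>r. P r" unfolding P_def by (rule rho_exists[OF k n])
    fix r s assume "P r" "P s"
    then show "r = s"
      using prime_cum_1_strict_mono[OF _ _ _ k, of r s] prime_cum_1_strict_mono[OF _ _ _ k, of s r]
      unfolding P_def by (cases r s rule: linorder_cases) auto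
  qed
  then have "P (THE r. P r)" by (rule theI')
  moreover have "rho k n = (THE r. P r)"
  proof -
    have "(0 < r \<and> r < 1 \<and> r * deriv (Phi k) r = real n) = P r" for r
      unfolding P_def using Phi_deriv[OF _ _ k, of r] by auto
    then show ?thesis unfolding rho_def by (simp only:)
  qed
  ultimately have "P (rho k n)" by simp
  then have "0 < rho k n \<and> rho k n < 1 \<and> (\<Sum>p. prime_cum k 1 (rho k n) p) = real n"
    unfolding P_def .
  then show "0 < rho k n" "rho k n < 1" "(\<Sum>p. prime_cum k 1 (rho k n) p) = real n" by auto
qed

section \<open>The asymptotic formula\<close>

text \<open>A part p^k of a partition of n satisfies p \<le> p^k \<le> n < N. The bound
  \<open>N\<close> stays free so that it can tend to infinity with \<open>n\<close> fixed.\<close>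

lemma partPk_eq_parts_count:
  assumes k: "k \<ge> 1" and N: "n < N"
  shows "partPk k n = parts_count ((\<lambda>p. p ^ k) ` {p. p < N \<and> prime p}) n"
proof -
  have "(\<forall>x\<in>#X. \<exists>p. prime p \<and> x = p ^ k) \<longleftrightarrow> set_mset X \<subseteq> (\<lambda>p. p ^ k) ` {p. p < N \<and> prime p}"
    if "sum_mset X = n" for X :: "nat multiset"
  proof -
    have "p < N" if x: "p ^ k \<in># X" "prime p" for p
    proof -
      have "p ^ 1 \<le> p ^ k" using k x(2) prime_gt_0_nat by (intro power_increasing) (auto simp: Suc_leI)
      moreover have "p ^ k \<le> sum_mset X"
        using x(1) by (metis multi_member_split sum_mset.add_mset le_add1)
      ultimately show ?thesis using N that \<open>sum_mset X = n\<close> by simp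
    qed
    then have "(\<exists>p. prime p \<and> x = p ^ k) \<longleftrightarrow> x \<in> (\<lambda>p. p ^ k) ` {p. p < N \<and> prime p}" if "x \<in># X" for x
      using that by auto
    then show ?thesis by blast
  qed
  then have "{X :: nat multiset. (\<forall>x\<in>#X. \<exists>p. prime p \<and> x = p ^ k) \<and> sum_mset X = n}
    = {X. set_mset X \<subseteq> (\<lambda>p. p ^ k) ` {p. p < N \<and> prime p} \<and> sum_mset X = n}"
    by blast
  then show ?thesis unfolding partPk_def parts_count_def by (rule arg_cong)
qed

text \<open>Let the finite set be the primes below N and let N tend to infinity with n and y fixed.
  The count is constant for N > n, variance and product converge, and the means converge to n by the
  definition of \<open>rho\<close>, which removes the recentring error.\<close>

lemma saddle_point_estimate:
  assumes k: "k \<ge> 1"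
  obtains C y0 where "C > 0" "y0 \<ge> 2"
    "\<And>y n. y \<ge> y0 \<Longrightarrow> n \<ge> 1 \<Longrightarrow> rho k n = exp (- (1 / y ^ k)) \<Longrightarrow>
       \<bar>real (partPk k n) * rho k n ^ n / Psi k (rho k n) - 1 / sqrt (2 * pi * Phi2 k (rho k n))\<bar>
       \<le> 1440 * y ^ (3 * k + 1) / (Phi2 k (rho k n))\<^sup>2 + C / y ^ (3 * k)"
proof -
  obtain C y0 where 1: "C > 0" "y0 \<ge> 2"
    "\<And>y S n r V. y \<ge> y0 \<Longrightarrow> finite S \<Longrightarrow> 0 \<notin> S \<Longrightarrow> {p. prime p \<and> real p \<le> y} \<subseteq> S \<Longrightarrow>
       r = exp (- (1 / y ^ k)) \<Longrightarrow> V = (\<Sum>p\<in>S. cum 2 r (p ^ k)) \<Longrightarrow>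
       \<bar>real (parts_count ((\<lambda>p. p ^ k) ` S) n) * r ^ n * (\<Prod>p\<in>S. 1 - r ^ (p ^ k)) - 1 / sqrt (2 * pi * V)\<bar>
       \<le> 1440 * y ^ (3 * k + 1) / V\<^sup>2 + C / y ^ (3 * k) + pi * \<bar>real n - (\<Sum>p\<in>S. cum 1 r (p ^ k))\<bar>"
    using finite_saddle_point[OF k] by blast
  show ?thesis
  proof (rule that[OF 1(1,2)])
    fix y n assume y: "y \<ge> y0" and n: "n \<ge> 1" and r_def: "rho k n = exp (- (1 / y ^ k))"
    define r where "r = rho k n"
    have r: "0 < r" "r < 1" "(\<Sum>p. prime_cum k 1 r p) = real n"
      using rho_spec[OF k n] by (simp_all add: r_def)
    define V where "V = Phi2 k r"
    have V: "V = (\<Sum>p. prime_cum k 2 r p)" unfolding V_def by (rule Phi2_eq[OF r(1,2) k])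
    have V0: "V > 0" unfolding V by (rule suminf_prime_cum_2_pos[OF r(1,2) k])
    define W where "W N = (\<Sum>p<N. prime_cum k 2 r p)" for N
    define \<mu> where "\<mu> N = (\<Sum>p<N. prime_cum k 1 r p)" for N
    define Q where "Q N = (\<Prod>p\<in>{p. p < N \<and> prime p}. 1 - r ^ (p ^ k))" for N
    have W: "W \<longlonglongrightarrow> V"
      unfolding W_def V using r k by (intro summable_LIMSEQ summable_prime_cum) simp_all
    have \<mu>: "\<mu> \<longlonglongrightarrow> real n"
      unfolding \<mu>_def r(3)[symmetric] using r k by (intro summable_LIMSEQ summable_prime_cum) simp_all
    have Q: "Q \<longlonglongrightarrow> 1 / Psi k r"
      unfolding Q_def by (rule prime_product_limit[OF r(1,2) k])
    have l1: "(\<lambda>N. \<bar>real (partPk k n) * r ^ n * Q N - 1 / sqrt (2 * pi * W N)\<bar>)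
        \<longlonglongrightarrow> \<bar>real (partPk k n) * r ^ n * (1 / Psi k r) - 1 / sqrt (2 * pi * V)\<bar>"
      using V0 by (intro tendsto_rabs tendsto_diff tendsto_mult_left Q tendsto_divide tendsto_const tendsto_real_sqrt W) simp
    have l2: "(\<lambda>N. 1440 * y ^ (3 * k + 1) / (W N)\<^sup>2 + C / y ^ (3 * k) + pi * \<bar>real n - \<mu> N\<bar>)
        \<longlonglongrightarrow> 1440 * y ^ (3 * k + 1) / V\<^sup>2 + C / y ^ (3 * k) + pi * \<bar>real n - real n\<bar>"
      using V0 by (intro tendsto_add tendsto_mult_left tendsto_rabs tendsto_diff tendsto_const \<mu> tendsto_divide tendsto_power W) simp
    have "\<bar>real (partPk k n) * r ^ n * (1 / Psi k r) - 1 / sqrt (2 * pi * V)\<bar>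
       \<le> 1440 * y ^ (3 * k + 1) / V\<^sup>2 + C / y ^ (3 * k) + pi * \<bar>real n - real n\<bar>"
    proof (rule LIMSEQ_le[OF l1 l2], intro exI allI impI)
      fix N assume N: "N \<ge> max (Suc n) (Suc (nat \<lfloor>y\<rfloor>))"
      let ?S = "{p. p < N \<and> prime p}"
      have pc: "partPk k n = parts_count ((\<lambda>p. p ^ k) ` ?S) n"
        using N by (intro partPk_eq_parts_count k) simp
      have S: "{p. prime p \<and> real p \<le> y} \<subseteq> ?S"
      proof
        fix p assume p: "p \<in> {p. prime p \<and> real p \<le> y}"
        then have "p \<le> nat \<lfloor>y\<rfloor>" by (simp add: le_nat_floor)
        with N p show "p \<in> ?S" by simp
      qed
      show "\<bar>real (partPk k n) * r ^ n * Q N - 1 / sqrt (2 * pi * W N)\<bar>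
          \<le> 1440 * y ^ (3 * k + 1) / (W N)\<^sup>2 + C / y ^ (3 * k) + pi * \<bar>real n - \<mu> N\<bar>"
        unfolding pc Q_def \<mu>_def W_def sum_prime_cum
        using y S by (intro 1(3)) (simp_all add: r_def[symmetric] r_def[unfolded \<open>rho k n = _\<close>])
    qed
    then show "\<bar>real (partPk k n) * rho k n ^ n / Psi k (rho k n) - 1 / sqrt (2 * pi * Phi2 k (rho k n))\<bar>
       \<le> 1440 * y ^ (3 * k + 1) / (Phi2 k (rho k n))\<^sup>2 + C / y ^ (3 * k)"
      unfolding V_def r_def by simp
  qed
qed

lemma Psi_pos: "0 < z \<Longrightarrow> z < 1 \<Longrightarrow> k \<ge> 1 \<Longrightarrow> 0 < Psi k z"
  by (simp add: Psi_eq)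

text \<open>The factor \<open>sqrt V\<close> turns an absolute error into a relative one. The lower
  bound for V controls sqrt V / V^2 = V^(-3/2); the upper bound controls the far-range term, which
  is of order at most y^(1/2 - 2k) \<le> y^(-1).\<close>

lemma saddle_error_bound:
  fixes V y A B C c :: real and k :: nat
  assumes k: "k \<ge> 1" and y: "y \<ge> 1" and pos: "A > 0" "B > 0" "C > 0" "c > 0"
    and V: "c * y powr (2 * k + 1 - 1 / (3 * (2 * k + 3))) \<le> V" "V \<le> B * y ^ (2 * k + 1)"
  shows "sqrt V * (A * y ^ (3 * k + 1) / V\<^sup>2 + C / y ^ (3 * k))
    \<le> (A * c powr (- 3 / 2) + C * sqrt B) * y powr (- real (k + 1) / real (2 * k + 3))"
proof -
  have V0: "V > 0" using V(1) pos y by (smt (verit) mult_pos_pos powr_gt_zero)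
  have "sqrt V / V\<^sup>2 = V powr (- 3 / 2)"
  proof -
    have "V powr (1 / 2) / V powr 2 = V powr (1 / 2 - 2)" by (rule powr_diff[symmetric])
    then show ?thesis using V0 by (simp add: powr_half_sqrt powr_numeral)
  qed
  also have "\<dots> \<le> (c * y powr (2 * k + 1 - 1 / (3 * (2 * k + 3)))) powr (- 3 / 2)"
    using V(1) pos y by (intro powr_mono2') auto
  also have "\<dots> = c powr (- 3 / 2) * y powr ((2 * k + 1 - 1 / (3 * (2 * k + 3))) * (- 3 / 2))"
    using pos y by (simp add: powr_mult powr_powr)
  finally have 1: "sqrt V / V\<^sup>2 \<le> c powr (- 3 / 2) * y powr ((2 * k + 1 - 1 / (3 * (2 * k + 3))) * (- 3 / 2))" .
  have "sqrt V * (A * y ^ (3 * k + 1) / V\<^sup>2) = A * y ^ (3 * k + 1) * (sqrt V / V\<^sup>2)" by simp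
  also have "\<dots> \<le> A * y ^ (3 * k + 1) * (c powr (- 3 / 2) * y powr ((2 * k + 1 - 1 / (3 * (2 * k + 3))) * (- 3 / 2)))"
    using 1 pos y by (intro mult_left_mono) auto
  also have "\<dots> = A * c powr (- 3 / 2) * (y powr (3 * k + 1) * y powr ((2 * k + 1 - 1 / (3 * (2 * k + 3))) * (- 3 / 2)))"
    using powr_realpow[of y "3 * k + 1"] y by (simp only: mult_ac)
  also have "y powr (3 * k + 1) * y powr ((2 * k + 1 - 1 / (3 * (2 * k + 3))) * (- 3 / 2)) = y powr (- real (k + 1) / real (2 * k + 3))"
  proof -
    have "(3 * k + 1) + (2 * k + 1 - 1 / (3 * (2 * k + 3))) * (- 3 / 2) = - (real k + 1) / (2 * k + 3)"
      by (simp add: divide_simps) (simp add: algebra_simps)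
    then show ?thesis by (simp only: powr_add[symmetric]) (simp add: add.commute)
  qed
  finally have first: "sqrt V * (A * y ^ (3 * k + 1) / V\<^sup>2) \<le> A * c powr (- 3 / 2) * y powr (- real (k + 1) / real (2 * k + 3))" .
  have "sqrt V \<le> sqrt (B * y ^ (2 * k + 1))" using V(2) by simp
  also have "\<dots> = sqrt B * y powr (k + 1 / 2)"
  proof -
    have e: "y ^ (2 * k + 1) = y powr (2 * k + 1)"
      using y by (intro powr_realpow[symmetric]) simp
    have "sqrt (y ^ (2 * k + 1)) = (y powr (2 * k + 1)) powr (1 / 2)"
      unfolding e by (intro powr_half_sqrt[symmetric]) simp
    also have "\<dots> = y powr ((2 * k + 1) * (1 / 2))" by (rule powr_powr)
    also have "(2 * k + 1) * (1 / 2) = real k + 1 / 2" by simp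
    finally show ?thesis by (simp only: real_sqrt_mult)
  qed
  finally have "sqrt V * (C / y ^ (3 * k)) \<le> sqrt B * y powr (k + 1 / 2) * (C / y ^ (3 * k))"
    using pos y by (intro mult_right_mono) auto
  also have "\<dots> = C * sqrt B * (y powr (k + 1 / 2) / y powr (3 * k))"
    using y by (simp add: powr_realpow[symmetric])
  also have "y powr (k + 1 / 2) / y powr (3 * k) = y powr (k + 1 / 2 - 3 * k)"
    by (rule powr_diff[symmetric])
  also have "C * sqrt B * \<dots> \<le> C * sqrt B * y powr (- real (k + 1) / real (2 * k + 3))"
  proof (intro mult_left_mono powr_mono)
    have "- 1 \<le> - real (k + 1) / real (2 * k + 3)" by (simp add: field_simps)
    moreover have "k + 1 / 2 - 3 * k \<le> - (1 :: real)" using k by simp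
    ultimately show "k + 1 / 2 - 3 * k \<le> - real (k + 1) / real (2 * k + 3)" by linarith
  qed (use y pos in auto)
  finally have "sqrt V * (C / y ^ (3 * k)) \<le> C * sqrt B * y powr (- real (k + 1) / real (2 * k + 3))" .
  with first show ?thesis unfolding distrib_left distrib_right by linarith
qed

theorem theorem1p3:
  fixes k :: nat
  assumes "k \<ge> 1"
  shows "(\<lambda>n. real (partPk k n) / main_term k n - 1)
           \<in> O(\<lambda>n. real n powr (- 1 / real (2 * k + 3)))"
proof -
  note k = assms
  obtain C y0 where C: "C > 0" "y0 \<ge> 2"
    "\<And>y n. y \<ge> y0 \<Longrightarrow> n \<ge> 1 \<Longrightarrow> rho k n = exp (- (1 / y ^ k)) \<Longrightarrow>
       \<bar>real (partPk k n) * rho k n ^ n / Psi k (rho k n) - 1 / sqrt (2 * pi * Phi2 k (rho k n))\<bar>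
       \<le> 1440 * y ^ (3 * k + 1) / (Phi2 k (rho k n))\<^sup>2 + C / y ^ (3 * k)"
    using saddle_point_estimate[OF k] by blast
  \<comment> \<open>The loss of y^\<delta> in V becomes y^(3\<delta>/2) in V^(-3/2), and 3\<delta>/2
    = 1/2 - (k+1)/(2k+3) is exactly the available slack.\<close>
  define \<delta> where "\<delta> = 1 / (3 * (2 * real k + 3))"
  have "\<delta> > 0" by (simp add: \<delta>_def)
  then obtain c where c: "c > 0" "\<And>x. x \<ge> 2 \<Longrightarrow> c * x powr (1 - \<delta>) \<le> real (card {p. prime p \<and> real p \<le> x})"
    using prime_count_lower by blast
  define D where "D = sqrt (2 * pi) * (1440 * (c / 3) powr (- 3 / 2) + C * sqrt 1440)"
  have D: "D \<ge> 0" unfolding D_def using C by (intro mult_nonneg_nonneg add_nonneg_nonneg) auto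
  define s where "s = 1 / real (2 * k + 3)"
  show ?thesis
  proof (rule bigoI[where c = "D * 1440 powr s"], rule eventually_sequentiallyI)
    \<comment> \<open>At the saddle point \<open>n \<le> 1440 * y ^ (k + 1)\<close>, so this
      threshold forces \<open>y \<ge> y0\<close>.\<close>
    fix n assume n0: "n \<ge> Suc (nat \<lceil>1440 * y0 ^ (k + 1)\<rceil>)"
    then have n: "n \<ge> 1" by simp
    have ny: "1440 * y0 ^ (k + 1) < real n" using n0 by linarith
    define r where "r = rho k n"
    have r: "0 < r" "r < 1" "(\<Sum>p. prime_cum k 1 r p) = real n"
      using rho_spec[OF k n] by (simp_all add: r_def)
    obtain y where y: "y > 0" "r = exp (- (1 / y ^ k))" using exp_root_param[OF r(1,2) k] .
    have n_le: "real n \<le> 1440 * y ^ (k + 1)"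
      using suminf_prime_cum_upper[OF y(1) k, of 1] unfolding y(2)[symmetric] r(3) by simp
    have yy0: "y \<ge> y0"
    proof (rule ccontr)
      assume "\<not> y \<ge> y0"
      then have "y ^ (k + 1) \<le> y0 ^ (k + 1)" using y by (intro power_mono) auto
      with ny n_le show False by linarith
    qed
    define V where "V = Phi2 k r"
    have V: "V = (\<Sum>p. prime_cum k 2 r p)" unfolding V_def by (rule Phi2_eq[OF r(1,2) k])
    have V0: "V > 0" unfolding V by (rule suminf_prime_cum_2_pos[OF r(1,2) k])
    have V_upper: "V \<le> 1440 * y ^ (2 * k + 1)"
      using suminf_prime_cum_upper[OF y(1) k, of 2] unfolding y(2)[symmetric] V by (simp add: mult.commute)
    have V_lower: "c / 3 * y powr (2 * k + 1 - \<delta>) \<le> V"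
    proof -
      have "y powr (2 * k + 1 - \<delta>) = y powr (real (2 * k) + (1 - \<delta>))" by (simp add: algebra_simps)
      also have "\<dots> = y ^ (2 * k) * y powr (1 - \<delta>)" using y by (simp only: powr_add powr_realpow)
      finally have "c / 3 * y powr (2 * k + 1 - \<delta>) = y ^ (2 * k) / 3 * (c * y powr (1 - \<delta>))" by simp
      also have "\<dots> \<le> y ^ (2 * k) / 3 * real (card {p. prime p \<and> real p \<le> y})"
        using y C yy0 by (intro mult_left_mono c) auto
      also have "\<dots> \<le> V" unfolding V y(2) by (rule suminf_prime_cum_2_lower[OF y(1) k])
      finally show ?thesis .
    qed
    have Psi: "Psi k r > 0" using r k by (intro Psi_pos)
    have main: "main_term k n = inverse (r ^ n) * Psi k r / sqrt (2 * pi * V)"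
      unfolding main_term_def Let_def r_def[symmetric] V_def using r
      by (simp add: powr_minus powr_realpow)
    have sq: "sqrt (2 * pi * V) > 0" using V0 by simp
    \<comment> \<open>The relative error is the deviation of the probability from its prediction 1 /
      sqrt (2 pi V), divided by that prediction.\<close>
    have "real (partPk k n) / main_term k n - 1 =
        sqrt (2 * pi * V) * (real (partPk k n) * r ^ n / Psi k r - 1 / sqrt (2 * pi * V))"
    proof -
      have key: "x / (inverse a * P / b) - 1 = b * (x * a / P - 1 / b)" if "a \<noteq> 0" "P \<noteq> 0" "b \<noteq> 0" for x a b P :: real
        using that by (simp add: field_simps)
      show ?thesis unfolding main by (rule key) (use sq Psi r in auto)
    qed
    then have "\<bar>real (partPk k n) / main_term k n - 1\<bar> =
        sqrt (2 * pi * V) * \<bar>real (partPk k n) * r ^ n / Psi k r - 1 / sqrt (2 * pi * V)\<bar>"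
      using sq by (simp only: abs_mult abs_of_pos)
    also have "\<dots> \<le> sqrt (2 * pi * V) * (1440 * y ^ (3 * k + 1) / V\<^sup>2 + C / y ^ (3 * k))"
      using C(3)[OF yy0 n] y(2) sq unfolding V_def r_def by (intro mult_left_mono) auto
    also have "\<dots> = sqrt (2 * pi) * (sqrt V * (1440 * y ^ (3 * k + 1) / V\<^sup>2 + C / y ^ (3 * k)))"
      by (simp only: real_sqrt_mult mult.assoc)
    also have "\<dots> \<le> sqrt (2 * pi) * ((1440 * (c / 3) powr (- 3 / 2) + C * sqrt 1440) * y powr (- real (k + 1) / real (2 * k + 3)))"
    proof (rule mult_left_mono[OF saddle_error_bound])
      show "c / 3 * y powr (2 * k + 1 - 1 / (3 * (2 * k + 3))) \<le> V"
        using V_lower by (simp add: \<delta>_def)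
    qed (use k yy0 C c V_upper in auto)
    also have "\<dots> = D * y powr (- real (k + 1) / real (2 * k + 3))" by (simp add: D_def)
    also have "\<dots> \<le> D * (1440 powr s * real n powr (- s))"
    proof (rule mult_left_mono[OF _ D])
      \<comment> \<open>The negative exponent reverses \<open>n_le\<close>, which converts the power
        of y into the required power of n.\<close>
      have "(1440 * y ^ (k + 1)) powr (- s) \<le> real n powr (- s)"
        using n_le n by (intro powr_mono2') (auto simp: s_def)
      then have "1440 powr s * (1440 * y ^ (k + 1)) powr (- s) \<le> 1440 powr s * real n powr (- s)"
        by (intro mult_left_mono) auto
      moreover have "1440 powr s * (1440 * y ^ (k + 1)) powr (- s) = y powr (- real (k + 1) / real (2 * k + 3))"
      proof -
        have "y ^ (k + 1) = y powr (k + 1)" using y by (intro powr_realpow[symmetric])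
        then have "(1440 * y ^ (k + 1)) powr (- s) = 1440 powr (- s) * (y powr (k + 1)) powr (- s)"
          using y by (simp only: powr_mult)
        also have "(y powr (k + 1)) powr (- s) = y powr (- real (k + 1) / real (2 * k + 3))"
          unfolding powr_powr s_def by (simp only: mult_minus_right times_divide_eq_right mult_1_right minus_divide_left)
        also have "1440 powr s * (1440 powr (- s) * \<dots>) = (1440 powr s * 1440 powr (- s)) * y powr (- real (k + 1) / real (2 * k + 3))"
          by (simp only: mult.assoc)
        also have "1440 powr s * 1440 powr (- s) = (1 :: real)" by (simp add: powr_add[symmetric])
        finally show ?thesis by simp
      qed
      ultimately show "y powr (- real (k + 1) / real (2 * k + 3)) \<le> 1440 powr s * real n powr (- s)" by (simp only:)
    qed
    finally show "norm (real (partPk k n) / main_term k n - 1) \<le> D * 1440 powr s * norm (real n powr (- 1 / real (2 * k + 3)))"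
      by (simp add: s_def mult.assoc)
  qed
qed

end
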